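(* If $M,N$ are typed terms and $M\to^* N$, then $[\![M]\!]=[\![N]\!]$, i.e. $[\![M]\!]\varepsilon=[\![N]\!]\varepsilon$ for every environment $\varepsilon$.
   Context: Types: type expressions $\sigma ::= t \mid \sigma+\sigma \mid \sigma\times\sigma\mid \sigma\to\sigma\mid \mu t.\sigma\mid \mathrm{void}$; types are closed type expressions; simple types $\tau::=\mathrm{void}\mid\tau+\tau\mid\tau\times\tau\mid\tau\to\tau$. $\preceq$: least relation with $\mathrm{void}\preceq\tau$ and $\sigma\preceq\sigma',\tau\preceq\tau'\Rightarrow\sigma\star\tau\preceq\sigma'\star\tau'$ ($\star\in\{+,\times,\to\}$, $\sigma,\tau$ simple). Unfolding $\rhd$: least relation with $\mu t.\tau\rhd\tau[\mu t.\tau/t]$, closed under $\star$ in either argument; $\tau\!\uparrow=\{\sigma\text{ simple}\mid\exists\tau'(\tau\rhd^*\tau',\sigma\preceq\tau')\}$. Type trees are non-empty, downward closed, directed sets of simple types; $\tau\!\uparrow$ is one. $\sigma\approx\tau$ iff $\sigma\!\uparrow=\tau\!\uparrow$. For type trees $\mathrm{void}=\{\mathrm{void}\}$, $\sigma\star\tau=\{\mathrm{void}\}\cup\{\sigma'\star\tau'\mid\sigma'\in\sigma,\tau'\in\tau\}$. Terms: variables $x^\sigma$ for each type $\sigma$; constants for all types $\sigma,\tau,\rho$: $0_{\sigma,\tau}:\sigma\to(\sigma+\tau)$, $1_{\sigma,\tau}:\tau\to(\sigma+\tau)$, $\mathrm{case}_{\sigma,\tau,\rho}:(\sigma+\tau)\to(\sigma\to\rho)\to(\tau\to\rho)\to\rho$,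 $\mathrm{pcase}_{\sigma,\tau,\rho}:(\sigma+\tau)\to\rho\to\rho\to\rho$, $\mathrm{pair}_{\sigma,\tau}:\sigma\to\tau\to(\sigma\times\tau)$, $\mathrm{fst}_{\sigma,\tau}:(\sigma\times\tau)\to\sigma$, $\mathrm{snd}_{\sigma,\tau}:(\sigma\times\tau)\to\tau$, $\Omega_\sigma:\sigma$. Typing: constants have their types; $x^\sigma:\sigma$; $M:\tau\Rightarrow\lambda x^\sigma.M:\sigma\to\tau$; $M:\sigma\to\tau,N:\sigma\Rightarrow MN:\tau$; $M:\sigma,\sigma\approx\tau\Rightarrow M:\tau$. Terms modulo $\alpha$-conversion; $(M,N)=\mathrm{pair}\,M\,N$. Reduction $\to$: least relation containing $\beta$ ($(\lambda x.M)N\to M[x:=N]$), closed under application in either position and under $\lambda$, and containing (for arbitrary terms $x,y,z,w,y_i,z_i$): $\mathrm{case}(0x)yz\to yx$; $\mathrm{case}(1x)yz\to zx$; $\mathrm{fst}(x,y)\to x$; $\mathrm{snd}(x,y)\to y$; $\mathrm{pcase}(0x)yz\to y$; $\mathrm{pcase}(1x)yz\to z$; $\mathrm{pcase}_{\sigma,\tau,\rho_0+\rho_1}x(0y)(0z)\to 0(\mathrm{pcase}_{\sigma,\tau,\rho_0}xyz)$; $\mathrm{pcase}_{\sigma,\tau,\rho_0+\rho_1}x(1y)(1z)\to 1(\mathrm{pcase}_{\sigma,\tau,\rho_1}xyz)$; $\mathrm{pcase}_{\sigma,\tau,\rho_1\times\rho_2}x(y_1,y_2)(z_1,z_2)\to(\mathrm{pcase}\,x\,y_1z_1,\mathrm{pcase}\,x\,y_2z_2)$;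 $(\mathrm{pcase}_{\sigma,\tau,\rho_1\to\rho_2}xyz)w\to\mathrm{pcase}_{\sigma,\tau,\rho_2}x(yw)(zw)$. $\to^*$: reflexive transitive closure. Semantics: a prime system $(A,\asymp,\le)$ has a set $A$ of primes, a reflexive symmetric consistency $\asymp$, a partial order $\le$, with $a\asymp b, c\le b\Rightarrow a\asymp c$. Its elements are the downward closed, pairwise consistent subsets of $A$, ordered by $\subseteq$; $\bot=\emptyset$; $\downarrow X=\{a\mid\exists b\in X,a\le b\}$. Sum $\mathbf A_0+\mathbf A_1$: primes $B_0\cup B_1$, $B_i=\{i\}\cup(\{i\}\times A_i)$; $a\asymp b$ iff both lie in one $B_i$ and, if $a=(i,a'),b=(i,b')$, $a'\asymp_ib'$; $a\le b$ iff ($a=i$, $b\in B_i$) or ($a=(i,a'),b=(i,b'),a'\le_ib'$). Product $\mathbf A_0\times\mathbf A_1$: primes $(\{0\}\times A_0)\cup(\{1\}\times A_1)$; $(i,a)\asymp(j,b)$ iff $i\ne j$ or $a\asymp_ib$; $(i,a)\le(j,b)$ iff $i=j$, $a\le_ib$. Function space $\mathbf A\to\mathbf B$: primes $(X,b)$, $X\subseteq A$ finite, pairwise consistent and pairwise $\le$-incomparable, $b\in B$; $(X,a)\asymp(Y,b)$ iff (all of $X$ consistent with all of $Y$ implies $a\asymp b$); $(X,a)\le(Y,b)$ iff $Y\subseteq\downarrow X$ and $a\le b$. An element $r$ of $\mathbf A\to\mathbf B$ denotes the continuous function $r\,d=\{a\mid\exists X\subseteq d,(X,a)\in r\}$; this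 is an order isomorphism onto the continuous functions between element domains, with inverse $\mathrm{Pr}(f)=\{(X,a)\mid a\in f(\downarrow X)\}$; curried functions of several arguments are converted by applying $\mathrm{Pr}$ iteratively. $\mathbf 0=(\emptyset,\emptyset,\emptyset)$. For a type tree $\sigma$: $\mathbf P_0(\sigma)=\mathbf 0$, $\mathbf P_{n+1}(\mathrm{void})=\mathbf 0$, $\mathbf P_{n+1}(\sigma\star\tau)=\mathbf P_n(\sigma)\star\mathbf P_n(\tau)$; these form an increasing chain (each prime set contains the previous one, with relations restricting), and $\mathbf P(\sigma)$ is its union (union of prime sets and of relations). $D_\sigma$ is the set of elements of $\mathbf P(\sigma)$; for a type $\sigma$, $D_\sigma=D_{\sigma\uparrow}$. In $D_{\sigma+\tau}$: $0d=\{0\}\cup(\{0\}\times d)$, $1d=\{1\}\cup(\{1\}\times d)$; in $D_{\sigma\times\tau}$: $\mathrm{pair}\,d\,e=(\{0\}\times d)\cup(\{1\}\times e)$. An environment $\varepsilon$ maps each variable $x^\sigma$ to an element of $D_\sigma$; $\varepsilon[x\mapsto d]$ updates $\varepsilon$ at $x$. The semantics: $[\![0]\!]\varepsilon=\mathrm{Pr}(d\mapsto 0d)$, $[\![1]\!]\varepsilon=\mathrm{Pr}(d\mapsto 1d)$; $[\![\mathrm{case}]\!]\varepsilon$ is (via $\mathrm{Pr}$) the function with $\mathrm{case}\,d\,f\,g=\bot$ if $d=\bot$, $=f\,e$ if $d=0e$, $=g\,e$ if $d=1e$; $[\![\mathrm{pcase}]\!]\varepsilon$ is the function with $\mathrm{pcase}\,a\,b\,c=b\cap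 c$ if $a=\bot$, $=b$ if $a=0a'$, $=c$ if $a=1a'$; $[\![\mathrm{pair}]\!]\varepsilon$ corresponds to $(d,e)\mapsto\mathrm{pair}\,d\,e$; $[\![\mathrm{fst}]\!]\varepsilon$, $[\![\mathrm{snd}]\!]\varepsilon$ correspond to $\mathrm{pair}\,d\,e\mapsto d$, resp. $e$; $[\![\Omega]\!]\varepsilon=\bot$; $[\![x]\!]\varepsilon=\varepsilon(x)$; $[\![\lambda x^\sigma.M]\!]\varepsilon=\mathrm{Pr}(d\in D_\sigma\mapsto[\![M]\!](\varepsilon[x\mapsto d]))$; $[\![MN]\!]\varepsilon=([\![M]\!]\varepsilon)([\![N]\!]\varepsilon)$. *)

theory Defs
  imports Main "HOL-Library.FSet"
begin

section \<open>Types and type trees\<close>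

datatype star = Plus | Times | Arrow

datatype tyexp = TVar nat | Star star tyexp tyexp | Mu nat tyexp | Void

primrec tfv :: "tyexp \<Rightarrow> nat set" where
  "tfv (TVar t) = {t}"
| "tfv (Star s \<sigma> \<tau>) = tfv \<sigma> \<union> tfv \<tau>"
| "tfv (Mu t \<sigma>) = tfv \<sigma> - {t}"
| "tfv Void = {}"

text \<open>Bound variables are not renamed here. Only closed expressions are ever unfolded, so the
  substituted expression is closed and nothing can be captured.\<close>

primrec tsubst :: "nat \<Rightarrow> tyexp \<Rightarrow> tyexp \<Rightarrow> tyexp" where
  "tsubst t \<rho> (TVar u) = (if u = t then \<rho> else TVar u)"
| "tsubst t \<rho> (Star s \<sigma> \<tau>) = Star s (tsubst t \<rho> \<sigma>) (tsubst t \<rho> \<tau>)"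
| "tsubst t \<rho> (Mu u \<sigma>) = (if u = t then Mu u \<sigma> else Mu u (tsubst t \<rho> \<sigma>))"
| "tsubst t \<rho> Void = Void"

inductive simple :: "tyexp \<Rightarrow> bool" where
  "simple Void"
| "simple \<sigma> \<Longrightarrow> simple \<tau> \<Longrightarrow> simple (Star s \<sigma> \<tau>)"

inductive tle :: "tyexp \<Rightarrow> tyexp \<Rightarrow> bool" (infix "\<preceq>" 50) where
  "Void \<preceq> \<tau>"
| "\<sigma> \<preceq> \<sigma>' \<Longrightarrow> \<tau> \<preceq> \<tau>' \<Longrightarrow> simple \<sigma> \<Longrightarrow> simple \<tau> \<Longrightarrow> Star s \<sigma> \<tau> \<preceq> Star s \<sigma>' \<tau>'"

inductive unfold :: "tyexp \<Rightarrow> tyexp \<Rightarrow> bool" (infix "\<rhd>" 50) where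
  "Mu t \<tau> \<rhd> tsubst t (Mu t \<tau>) \<tau>"
| "\<sigma> \<rhd> \<sigma>' \<Longrightarrow> Star s \<sigma> \<tau> \<rhd> Star s \<sigma>' \<tau>"
| "\<tau> \<rhd> \<tau>' \<Longrightarrow> Star s \<sigma> \<tau> \<rhd> Star s \<sigma> \<tau>'"

definition unfolding_tree :: "tyexp \<Rightarrow> tyexp set" where
  "unfolding_tree \<tau> = {\<sigma>. simple \<sigma> \<and> (\<exists>\<tau>'. (\<rhd>)\<^sup>*\<^sup>* \<tau> \<tau>' \<and> \<sigma> \<preceq> \<tau>')}"

definition type_tree :: "tyexp set \<Rightarrow> bool" where
  "type_tree T \<longleftrightarrow> T \<noteq> {} \<and> (\<forall>\<tau>\<in>T. simple \<tau>) \<and>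
     (\<forall>\<tau>\<in>T. \<forall>\<sigma>. \<sigma> \<preceq> \<tau> \<longrightarrow> \<sigma> \<in> T) \<and>
     (\<forall>\<sigma>\<in>T. \<forall>\<tau>\<in>T. \<exists>\<rho>\<in>T. \<sigma> \<preceq> \<rho> \<and> \<tau> \<preceq> \<rho>)"

definition tree_star :: "star \<Rightarrow> tyexp set \<Rightarrow> tyexp set \<Rightarrow> tyexp set" where
  "tree_star s S T = {Void} \<union> {Star s \<sigma> \<tau> |\<sigma> \<tau>. \<sigma> \<in> S \<and> \<tau> \<in> T}"

typedef ty = "{\<sigma>. tfv \<sigma> = {}}"
  by (rule exI[of _ Void]) simp

setup_lifting type_definition_ty

lift_definition ty_star :: "star \<Rightarrow> ty \<Rightarrow> ty \<Rightarrow> ty" is Star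
  by simp

abbreviation ty_sum (infixr "\<oplus>" 65) where "\<sigma> \<oplus> \<tau> \<equiv> ty_star Plus \<sigma> \<tau>"
abbreviation ty_prod (infixr "\<otimes>" 70) where "\<sigma> \<otimes> \<tau> \<equiv> ty_star Times \<sigma> \<tau>"
abbreviation ty_fun (infixr "\<Rrightarrow>" 60) where "\<sigma> \<Rrightarrow> \<tau> \<equiv> ty_star Arrow \<sigma> \<tau>"

lift_definition tree :: "ty \<Rightarrow> tyexp set" is unfolding_tree .

definition ty_equiv :: "ty \<Rightarrow> ty \<Rightarrow> bool" (infix "\<approx>" 50) where
  "\<sigma> \<approx> \<tau> \<longleftrightarrow> tree \<sigma> = tree \<tau>"


section \<open>Prime systems\<close>

text \<open>One datatype holds the primes of all prime systems: \<open>Tag i\<close> is the prime $i$ of a sum,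
  \<open>At i a\<close> the prime $(i,a)$ of a sum or product, \<open>Step X b\<close> the prime $(X,b)$ of a function
  space. The indices used are $0$ and $1$.\<close>

datatype prime = Tag nat | At nat prime | Step "prime fset" prime

record psys =
  Primes :: "prime set"
  Con :: "(prime \<times> prime) set"
  Le :: "(prime \<times> prime) set"

definition elements :: "psys \<Rightarrow> prime set set" where
  "elements A = {d. d \<subseteq> Primes A \<and> (\<forall>b\<in>d. \<forall>a. (a, b) \<in> Le A \<longrightarrow> a \<in> d) \<and>
     (\<forall>a\<in>d. \<forall>b\<in>d. (a, b) \<in> Con A)}"

definition down :: "psys \<Rightarrow> prime set \<Rightarrow> prime set" where
  "down A X = {a. \<exists>b\<in>X. (a, b) \<in> Le A}"

definition pzero :: psys where
  "pzero = \<lparr>Primes = {}, Con = {}, Le = {}\<rparr>"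

definition summand :: "nat \<Rightarrow> psys \<Rightarrow> prime set" where
  "summand i A = {Tag i} \<union> At i ` Primes A"

definition psum :: "psys \<Rightarrow> psys \<Rightarrow> psys" where
  "psum A0 A1 = \<lparr>
     Primes = summand 0 A0 \<union> summand 1 A1,
     Con = {(a, b). \<exists>(i, A)\<in>{(0, A0), (1, A1)}. a \<in> summand i A \<and> b \<in> summand i A \<and>
              (\<forall>a' b'. a = At i a' \<and> b = At i b' \<longrightarrow> (a', b') \<in> Con A)},
     Le = {(a, b). \<exists>(i, A)\<in>{(0, A0), (1, A1)}. a = Tag i \<and> b \<in> summand i A \<or>
              (\<exists>a' b'. a = At i a' \<and> b = At i b' \<and> (a', b') \<in> Le A)}\<rparr>"

definition pprod :: "psys \<Rightarrow> psys \<Rightarrow> psys" where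
  "pprod A0 A1 = \<lparr>
     Primes = At 0 ` Primes A0 \<union> At 1 ` Primes A1,
     Con = {(At i a, At j b) |i a j b. \<exists>A B. (i, A) \<in> {(0, A0), (1, A1)} \<and>
              (j, B) \<in> {(0, A0), (1, A1)} \<and> a \<in> Primes A \<and> b \<in> Primes B \<and>
              (i \<noteq> j \<or> (a, b) \<in> Con A)},
     Le = {(At i a, At i b) |i a b. \<exists>A. (i, A) \<in> {(0, A0), (1, A1)} \<and> (a, b) \<in> Le A}\<rparr>"

definition antichains :: "psys \<Rightarrow> prime fset set" where
  "antichains A = {X. fset X \<subseteq> Primes A \<and>
     (\<forall>a\<in>fset X. \<forall>b\<in>fset X. (a, b) \<in> Con A) \<and>
     (\<forall>a\<in>fset X. \<forall>b\<in>fset X. a \<noteq> b \<longrightarrow> (a, b) \<notin> Le A)}"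

definition pfun :: "psys \<Rightarrow> psys \<Rightarrow> psys" where
  "pfun A B = \<lparr>
     Primes = {Step X b |X b. X \<in> antichains A \<and> b \<in> Primes B},
     Con = {(Step X a, Step Y b) |X a Y b. X \<in> antichains A \<and> Y \<in> antichains A \<and>
              a \<in> Primes B \<and> b \<in> Primes B \<and>
              ((\<forall>x\<in>fset X. \<forall>y\<in>fset Y. (x, y) \<in> Con A) \<longrightarrow> (a, b) \<in> Con B)},
     Le = {(Step X a, Step Y b) |X a Y b. X \<in> antichains A \<and> Y \<in> antichains A \<and>
              a \<in> Primes B \<and> b \<in> Primes B \<and>
              fset Y \<subseteq> down A (fset X) \<and> (a, b) \<in> Le B}\<rparr>"

primrec pstar :: "star \<Rightarrow> psys \<Rightarrow> psys \<Rightarrow> psys" where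
  "pstar Plus = psum"
| "pstar Times = pprod"
| "pstar Arrow = pfun"

text \<open>A type tree other than \<open>{Void}\<close> is \<open>tree_star s S T\<close> for unique \<open>s\<close>, \<open>S\<close>, \<open>T\<close>; the
  lemmas below give the resulting recursion equations.\<close>

primrec Papprox :: "nat \<Rightarrow> tyexp set \<Rightarrow> psys" where
  "Papprox 0 U = pzero"
| "Papprox (Suc n) U =
     (if \<exists>s S T. type_tree S \<and> type_tree T \<and> U = tree_star s S T
      then (case THE (s, S, T). type_tree S \<and> type_tree T \<and> U = tree_star s S T of
              (s, S, T) \<Rightarrow> pstar s (Papprox n S) (Papprox n T))
      else pzero)"

lemma tree_star_inject:
  assumes "type_tree S" "type_tree T" "type_tree S'" "type_tree T'"
    and "tree_star s S T = tree_star s' S' T'"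
  shows "s = s' \<and> S = S' \<and> T = T'"
proof -
  have 1: "Star r \<sigma> \<tau> \<in> tree_star s S T \<longleftrightarrow> r = s \<and> \<sigma> \<in> S \<and> \<tau> \<in> T" for r \<sigma> \<tau>
    by (auto simp: tree_star_def)
  have 2: "Star r \<sigma> \<tau> \<in> tree_star s S T \<longleftrightarrow> r = s' \<and> \<sigma> \<in> S' \<and> \<tau> \<in> T'" for r \<sigma> \<tau>
    unfolding assms(5) by (auto simp: tree_star_def)
  have 3: "r = s \<and> \<sigma> \<in> S \<and> \<tau> \<in> T \<longleftrightarrow> r = s' \<and> \<sigma> \<in> S' \<and> \<tau> \<in> T'" for r \<sigma> \<tau>
    using 1[of r \<sigma> \<tau>] 2[of r \<sigma> \<tau>] by simp
  obtain \<sigma>0 \<tau>0 where 4: "\<sigma>0 \<in> S" "\<tau>0 \<in> T"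
    using assms(1,2) by (auto simp: type_tree_def)
  hence 5: "s = s'" "\<sigma>0 \<in> S'" "\<tau>0 \<in> T'"
    using 3[of s \<sigma>0 \<tau>0] by simp_all
  have "S = S'" using 3[of s _ \<tau>0] 4 5 by auto
  moreover have "T = T'" using 3[of s \<sigma>0] 4 5 by auto
  ultimately show ?thesis using 5 by simp
qed

lemma Papprox_Void: "Papprox (Suc n) {Void} = pzero"
proof -
  have "{Void} \<noteq> tree_star s S T" if "type_tree S" "type_tree T" for s S T
  proof -
    obtain \<sigma> \<tau> where "\<sigma> \<in> S" "\<tau> \<in> T"
      using \<open>type_tree S\<close> \<open>type_tree T\<close> by (auto simp: type_tree_def)
    hence "Star s \<sigma> \<tau> \<in> tree_star s S T" by (auto simp: tree_star_def)
    thus ?thesis by auto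
  qed
  thus ?thesis by auto
qed

lemma Papprox_star:
  assumes "type_tree S" "type_tree T"
  shows "Papprox (Suc n) (tree_star s S T) = pstar s (Papprox n S) (Papprox n T)"
proof -
  have "(THE (s', S', T'). type_tree S' \<and> type_tree T' \<and> tree_star s S T = tree_star s' S' T')
      = (s, S, T)"
  proof (rule the_equality)
    show "case (s, S, T) of (s', S', T') \<Rightarrow>
        type_tree S' \<and> type_tree T' \<and> tree_star s S T = tree_star s' S' T'"
      using assms by simp
  next
    fix q assume "case q of (s', S', T') \<Rightarrow>
        type_tree S' \<and> type_tree T' \<and> tree_star s S T = tree_star s' S' T'"
    thus "q = (s, S, T)"
      using tree_star_inject[OF assms] by (cases q) auto
  qed
  moreover have "\<exists>s' S' T'. type_tree S' \<and> type_tree T' \<and> tree_star s S T = tree_star s' S' T'"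
    using assms by blast
  ultimately show ?thesis by (simp only: Papprox.simps if_True prod.case)
qed

definition P :: "tyexp set \<Rightarrow> psys" where
  "P U = \<lparr>Primes = (\<Union>n. Primes (Papprox n U)),
          Con = (\<Union>n. Con (Papprox n U)),
          Le = (\<Union>n. Le (Papprox n U))\<rparr>"

abbreviation Pty :: "ty \<Rightarrow> psys" where
  "Pty \<sigma> \<equiv> P (tree \<sigma>)"

definition D :: "ty \<Rightarrow> prime set set" where
  "D \<sigma> = elements (Pty \<sigma>)"

definition fapp :: "prime set \<Rightarrow> prime set \<Rightarrow> prime set" where
  "fapp r d = {a. \<exists>X. fset X \<subseteq> d \<and> Step X a \<in> r}"

text \<open>The prime system \<open>A\<close> is that of the argument domain.\<close>

definition Pr :: "psys \<Rightarrow> (prime set \<Rightarrow> prime set) \<Rightarrow> prime set" where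
  "Pr A f = {Step X a |X a. X \<in> antichains A \<and> a \<in> f (down A (fset X))}"

definition inj_el :: "nat \<Rightarrow> prime set \<Rightarrow> prime set" where
  "inj_el i d = {Tag i} \<union> At i ` d"

definition proj_el :: "nat \<Rightarrow> prime set \<Rightarrow> prime set" where
  "proj_el i d = {a. At i a \<in> d}"

definition pair_el :: "prime set \<Rightarrow> prime set \<Rightarrow> prime set" where
  "pair_el d e = At 0 ` d \<union> At 1 ` e"

definition case_el :: "prime set \<Rightarrow> prime set \<Rightarrow> prime set \<Rightarrow> prime set" where
  "case_el d f g =
     (if d = inj_el 0 (proj_el 0 d) then fapp f (proj_el 0 d)
      else if d = inj_el 1 (proj_el 1 d) then fapp g (proj_el 1 d)
      else {})"

definition pcase_el :: "prime set \<Rightarrow> prime set \<Rightarrow> prime set \<Rightarrow> prime set" where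
  "pcase_el a b c =
     (if a = inj_el 0 (proj_el 0 a) then b
      else if a = inj_el 1 (proj_el 1 a) then c
      else b \<inter> c)"

lemma proj_inj_el: "proj_el i (inj_el i d) = d"
  by (auto simp: proj_el_def inj_el_def)

lemma proj_pair_el: "proj_el 0 (pair_el d e) = d" "proj_el 1 (pair_el d e) = e"
  by (auto simp: proj_el_def pair_el_def)

lemma inj_el_distinct:
  "{} \<noteq> inj_el i d" "inj_el (Suc 0) d \<noteq> inj_el 0 e"
  by (auto simp: inj_el_def)

lemma case_el_eqs:
  "case_el {} f g = {}"
  "case_el (inj_el 0 e) f g = fapp f e"
  "case_el (inj_el 1 e) f g = fapp g e"
  by (simp_all add: case_el_def proj_inj_el inj_el_distinct)

lemma pcase_el_eqs:
  "pcase_el {} b c = b \<inter> c"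
  "pcase_el (inj_el 0 a) b c = b"
  "pcase_el (inj_el 1 a) b c = c"
  by (simp_all add: pcase_el_def proj_inj_el inj_el_distinct)


section \<open>Terms modulo alpha-conversion\<close>

datatype cnst =
    Inj0 ty ty | Inj1 ty ty | Case ty ty ty | PCase ty ty ty
  | Pair ty ty | Fst ty ty | Snd ty ty | Omega ty

primrec ctype :: "cnst \<Rightarrow> ty" where
  "ctype (Inj0 \<sigma> \<tau>) = (\<sigma> \<Rrightarrow> \<sigma> \<oplus> \<tau>)"
| "ctype (Inj1 \<sigma> \<tau>) = (\<tau> \<Rrightarrow> \<sigma> \<oplus> \<tau>)"
| "ctype (Case \<sigma> \<tau> \<rho>) = (\<sigma> \<oplus> \<tau> \<Rrightarrow> (\<sigma> \<Rrightarrow> \<rho>) \<Rrightarrow> (\<tau> \<Rrightarrow> \<rho>) \<Rrightarrow> \<rho>)"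
| "ctype (PCase \<sigma> \<tau> \<rho>) = (\<sigma> \<oplus> \<tau> \<Rrightarrow> \<rho> \<Rrightarrow> \<rho> \<Rrightarrow> \<rho>)"
| "ctype (Pair \<sigma> \<tau>) = (\<sigma> \<Rrightarrow> \<tau> \<Rrightarrow> \<sigma> \<otimes> \<tau>)"
| "ctype (Fst \<sigma> \<tau>) = (\<sigma> \<otimes> \<tau> \<Rrightarrow> \<sigma>)"
| "ctype (Snd \<sigma> \<tau>) = (\<sigma> \<otimes> \<tau> \<Rrightarrow> \<tau>)"
| "ctype (Omega \<sigma>) = \<sigma>"

text \<open>The variable $x^\sigma$ is the pair \<open>(x, \<sigma>)\<close>.\<close>

type_synonym var = "nat \<times> ty"

datatype raw = RVar var | RConst cnst | RApp raw raw | RLam var raw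

primrec fv :: "raw \<Rightarrow> var set" where
  "fv (RVar x) = {x}"
| "fv (RConst c) = {}"
| "fv (RApp M N) = fv M \<union> fv N"
| "fv (RLam x M) = fv M - {x}"

definition fresh :: "ty \<Rightarrow> var set \<Rightarrow> var" where
  "fresh \<sigma> V = (LEAST n. (n, \<sigma>) \<notin> V, \<sigma>)"

text \<open>Simultaneous capture-avoiding substitution. Every binder is renamed to a variable of the same
  type that is fresh for the substituted terms, which makes the recursion structural.\<close>

primrec rsubst :: "raw \<Rightarrow> (var \<Rightarrow> raw) \<Rightarrow> raw" where
  "rsubst (RVar x) \<theta> = \<theta> x"
| "rsubst (RConst c) \<theta> = RConst c"
| "rsubst (RApp M N) \<theta> = RApp (rsubst M \<theta>) (rsubst N \<theta>)"
| "rsubst (RLam x M) \<theta> =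
     (let z = fresh (snd x) (\<Union>y\<in>fv (RLam x M). fv (\<theta> y))
      in RLam z (rsubst M (\<theta>(x := RVar z))))"

abbreviation rsubst1 :: "raw \<Rightarrow> var \<Rightarrow> raw \<Rightarrow> raw" ("_[_ :=\<^sub>r _]" [1000, 0, 0] 1000) where
  "M[x :=\<^sub>r N] \<equiv> rsubst M (RVar(x := N))"

inductive alpha :: "raw \<Rightarrow> raw \<Rightarrow> bool" where
  alpha_rename: "snd y = snd x \<Longrightarrow> y \<notin> fv M \<Longrightarrow> alpha (RLam x M) (RLam y (M[x :=\<^sub>r RVar y]))"
| alpha_refl: "alpha M M"
| alpha_sym: "alpha M N \<Longrightarrow> alpha N M"
| alpha_trans: "alpha L M \<Longrightarrow> alpha M N \<Longrightarrow> alpha L N"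
| alpha_app: "alpha M M' \<Longrightarrow> alpha N N' \<Longrightarrow> alpha (RApp M N) (RApp M' N')"
| alpha_lam: "alpha M M' \<Longrightarrow> alpha (RLam x M) (RLam x M')"

quotient_type trm = raw / alpha
  by (rule equivpI)
    (auto simp: reflp_def symp_def transp_def intro: alpha_refl alpha_sym alpha_trans)

lift_definition Var :: "var \<Rightarrow> trm" is RVar .
lift_definition Const :: "cnst \<Rightarrow> trm" is RConst .
lift_definition App :: "trm \<Rightarrow> trm \<Rightarrow> trm" (infixl "\<cdot>" 100) is RApp by (rule alpha_app)
lift_definition Lam :: "var \<Rightarrow> trm \<Rightarrow> trm" is RLam by (rule alpha_lam)

text \<open>The class of a raw term.\<close>

lift_definition cls :: "raw \<Rightarrow> trm" is "\<lambda>M. M" .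

inductive has_type :: "trm \<Rightarrow> ty \<Rightarrow> bool" (infix "\<Colon>" 50) where
  "Const c \<Colon> ctype c"
| "Var (x, \<sigma>) \<Colon> \<sigma>"
| "M \<Colon> \<tau> \<Longrightarrow> Lam (x, \<sigma>) M \<Colon> \<sigma> \<Rrightarrow> \<tau>"
| "M \<Colon> \<sigma> \<Rrightarrow> \<tau> \<Longrightarrow> N \<Colon> \<sigma> \<Longrightarrow> M \<cdot> N \<Colon> \<tau>"
| "M \<Colon> \<sigma> \<Longrightarrow> \<sigma> \<approx> \<tau> \<Longrightarrow> M \<Colon> \<tau>"


section \<open>Reduction\<close>

text \<open>Primed type indices are unconstrained: they are those the informal rules leave implicit on the
  left. The constants created on the right carry the indices that make them fit the index of
  \<open>PCase\<close>. The beta rule ranges over all representatives of the two classes.\<close>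

inductive red :: "trm \<Rightarrow> trm \<Rightarrow> bool" (infix "\<leadsto>" 50) where
  beta: "Lam x (cls M) \<cdot> cls N \<leadsto> cls (M[x :=\<^sub>r N])"
| appL: "M \<leadsto> M' \<Longrightarrow> M \<cdot> N \<leadsto> M' \<cdot> N"
| appR: "N \<leadsto> N' \<Longrightarrow> M \<cdot> N \<leadsto> M \<cdot> N'"
| lam: "M \<leadsto> M' \<Longrightarrow> Lam x M \<leadsto> Lam x M'"
| case0: "Const (Case \<sigma> \<tau> \<rho>) \<cdot> (Const (Inj0 \<sigma>' \<tau>') \<cdot> x) \<cdot> y \<cdot> z \<leadsto> y \<cdot> x"
| case1: "Const (Case \<sigma> \<tau> \<rho>) \<cdot> (Const (Inj1 \<sigma>' \<tau>') \<cdot> x) \<cdot> y \<cdot> z \<leadsto> z \<cdot> x"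
| fst: "Const (Fst \<sigma> \<tau>) \<cdot> (Const (Pair \<sigma>' \<tau>') \<cdot> x \<cdot> y) \<leadsto> x"
| snd: "Const (Snd \<sigma> \<tau>) \<cdot> (Const (Pair \<sigma>' \<tau>') \<cdot> x \<cdot> y) \<leadsto> y"
| pcase0: "Const (PCase \<sigma> \<tau> \<rho>) \<cdot> (Const (Inj0 \<sigma>' \<tau>') \<cdot> x) \<cdot> y \<cdot> z \<leadsto> y"
| pcase1: "Const (PCase \<sigma> \<tau> \<rho>) \<cdot> (Const (Inj1 \<sigma>' \<tau>') \<cdot> x) \<cdot> y \<cdot> z \<leadsto> z"
| pcase_inj0:
    "Const (PCase \<sigma> \<tau> (\<rho>0 \<oplus> \<rho>1)) \<cdot> x \<cdot> (Const (Inj0 \<sigma>' \<tau>') \<cdot> y) \<cdot> (Const (Inj0 \<sigma>'' \<tau>'') \<cdot> z)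
       \<leadsto> Const (Inj0 \<rho>0 \<rho>1) \<cdot> (Const (PCase \<sigma> \<tau> \<rho>0) \<cdot> x \<cdot> y \<cdot> z)"
| pcase_inj1:
    "Const (PCase \<sigma> \<tau> (\<rho>0 \<oplus> \<rho>1)) \<cdot> x \<cdot> (Const (Inj1 \<sigma>' \<tau>') \<cdot> y) \<cdot> (Const (Inj1 \<sigma>'' \<tau>'') \<cdot> z)
       \<leadsto> Const (Inj1 \<rho>0 \<rho>1) \<cdot> (Const (PCase \<sigma> \<tau> \<rho>1) \<cdot> x \<cdot> y \<cdot> z)"
| pcase_pair:
    "Const (PCase \<sigma> \<tau> (\<rho>1 \<otimes> \<rho>2)) \<cdot> x \<cdot> (Const (Pair \<sigma>' \<tau>') \<cdot> y1 \<cdot> y2)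
         \<cdot> (Const (Pair \<sigma>'' \<tau>'') \<cdot> z1 \<cdot> z2)
       \<leadsto> Const (Pair \<rho>1 \<rho>2) \<cdot> (Const (PCase \<sigma> \<tau> \<rho>1) \<cdot> x \<cdot> y1 \<cdot> z1)
            \<cdot> (Const (PCase \<sigma> \<tau> \<rho>2) \<cdot> x \<cdot> y2 \<cdot> z2)"
| pcase_fun:
    "Const (PCase \<sigma> \<tau> (\<rho>1 \<Rrightarrow> \<rho>2)) \<cdot> x \<cdot> y \<cdot> z \<cdot> w
       \<leadsto> Const (PCase \<sigma> \<tau> \<rho>2) \<cdot> x \<cdot> (y \<cdot> w) \<cdot> (z \<cdot> w)"


section \<open>Semantics\<close>

type_synonym env = "var \<Rightarrow> prime set"

definition environment :: "env \<Rightarrow> bool" where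
  "environment \<epsilon> \<longleftrightarrow> (\<forall>x \<sigma>. \<epsilon> (x, \<sigma>) \<in> D \<sigma>)"

primrec sem_const :: "cnst \<Rightarrow> prime set" where
  "sem_const (Inj0 \<sigma> \<tau>) = Pr (Pty \<sigma>) (\<lambda>d. inj_el 0 d)"
| "sem_const (Inj1 \<sigma> \<tau>) = Pr (Pty \<tau>) (\<lambda>d. inj_el 1 d)"
| "sem_const (Case \<sigma> \<tau> \<rho>) =
     Pr (Pty (\<sigma> \<oplus> \<tau>)) (\<lambda>d. Pr (Pty (\<sigma> \<Rrightarrow> \<rho>)) (\<lambda>f. Pr (Pty (\<tau> \<Rrightarrow> \<rho>)) (\<lambda>g. case_el d f g)))"
| "sem_const (PCase \<sigma> \<tau> \<rho>) =
     Pr (Pty (\<sigma> \<oplus> \<tau>)) (\<lambda>a. Pr (Pty \<rho>) (\<lambda>b. Pr (Pty \<rho>) (\<lambda>c. pcase_el a b c)))"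
| "sem_const (Pair \<sigma> \<tau>) = Pr (Pty \<sigma>) (\<lambda>d. Pr (Pty \<tau>) (\<lambda>e. pair_el d e))"
| "sem_const (Fst \<sigma> \<tau>) = Pr (Pty (\<sigma> \<otimes> \<tau>)) (\<lambda>p. proj_el 0 p)"
| "sem_const (Snd \<sigma> \<tau>) = Pr (Pty (\<sigma> \<otimes> \<tau>)) (\<lambda>p. proj_el 1 p)"
| "sem_const (Omega \<sigma>) = {}"

primrec sem_raw :: "raw \<Rightarrow> env \<Rightarrow> prime set" where
  "sem_raw (RVar x) \<epsilon> = \<epsilon> x"
| "sem_raw (RConst c) \<epsilon> = sem_const c"
| "sem_raw (RApp M N) \<epsilon> = fapp (sem_raw M \<epsilon>) (sem_raw N \<epsilon>)"
| "sem_raw (RLam x M) \<epsilon> = Pr (Pty (snd x)) (\<lambda>d. sem_raw M (\<epsilon>(x := d)))"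

lemma finite_fv: "finite (fv M)"
  by (induction M) auto

lemma fresh_notin: "finite V \<Longrightarrow> fresh \<sigma> V \<notin> V"
proof -
  assume "finite V"
  hence "finite (fst ` V)" by simp
  then obtain n where "n \<notin> fst ` V" using ex_new_if_finite infinite_UNIV_nat by blast
  hence "(n, \<sigma>) \<notin> V" by force
  thus ?thesis unfolding fresh_def by (rule LeastI)
qed

lemma snd_fresh: "snd (fresh \<sigma> V) = \<sigma>"
  by (simp add: fresh_def)

lemma sem_raw_cong: "(\<And>x. x \<in> fv M \<Longrightarrow> \<epsilon> x = \<epsilon>' x) \<Longrightarrow> sem_raw M \<epsilon> = sem_raw M \<epsilon>'"
proof (induction M arbitrary: \<epsilon> \<epsilon>')
  case (RApp M N)
  have "sem_raw M \<epsilon> = sem_raw M \<epsilon>'" "sem_raw N \<epsilon> = sem_raw N \<epsilon>'"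
    using RApp.prems by (auto intro!: RApp.IH)
  thus ?case by simp
next
  case (RLam x M)
  have "sem_raw M (\<epsilon>(x := d)) = sem_raw M (\<epsilon>'(x := d))" for d
    using RLam.prems by (intro RLam.IH) auto
  thus ?case by simp
qed auto

lemma sem_raw_rsubst: "sem_raw (rsubst M \<theta>) \<epsilon> = sem_raw M (\<lambda>x. sem_raw (\<theta> x) \<epsilon>)"
proof (induction M arbitrary: \<theta> \<epsilon>)
  case (RLam x M)
  define V where "V = (\<Union>y\<in>fv (RLam x M). fv (\<theta> y))"
  define z where "z = fresh (snd x) V"
  have "finite V" unfolding V_def by (intro finite_UN_I finite_fv)
  hence z: "z \<notin> V" "snd z = snd x"
    by (simp_all add: z_def fresh_notin snd_fresh)
  have "sem_raw M (\<lambda>y. sem_raw ((\<theta>(x := RVar z)) y) (\<epsilon>(z := d)))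
      = sem_raw M ((\<lambda>y. sem_raw (\<theta> y) \<epsilon>)(x := d))" for d
  proof (rule sem_raw_cong)
    fix y assume y: "y \<in> fv M"
    show "sem_raw ((\<theta>(x := RVar z)) y) (\<epsilon>(z := d)) = ((\<lambda>y. sem_raw (\<theta> y) \<epsilon>)(x := d)) y"
    proof (cases "y = x")
      case False
      with y z(1) have "z \<notin> fv (\<theta> y)" by (auto simp: V_def)
      hence "sem_raw (\<theta> y) (\<epsilon>(z := d)) = sem_raw (\<theta> y) \<epsilon>"
        by (intro sem_raw_cong) (metis fun_upd_other)
      with False show ?thesis by simp
    qed simp
  qed
  moreover have "rsubst (RLam x M) \<theta> = RLam z (rsubst M (\<theta>(x := RVar z)))"
    by (simp add: z_def V_def Let_def)
  ultimately show ?case using z(2) by (simp add: RLam.IH del: rsubst.simps fun_upd_apply)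
qed auto

lemma sem_raw_alpha: "alpha M N \<Longrightarrow> sem_raw M = sem_raw N"
proof (induction rule: alpha.induct)
  case (alpha_rename y x M)
  have *: "sem_raw M (\<lambda>w. sem_raw ((RVar(x := RVar y)) w) (\<epsilon>(y := d))) = sem_raw M (\<epsilon>(x := d))"
    for \<epsilon> d
  proof (rule sem_raw_cong)
    fix w assume "w \<in> fv M"
    with alpha_rename(2) have "w \<noteq> y" by blast
    thus "sem_raw ((RVar(x := RVar y)) w) (\<epsilon>(y := d)) = (\<epsilon>(x := d)) w" by simp
  qed
  show ?case
    by (rule ext) (simp only: sem_raw.simps sem_raw_rsubst * alpha_rename(1))
next
  case (alpha_refl M)
  show ?case by (rule refl)
next
  case (alpha_sym M N)
  show ?case by (rule alpha_sym.IH[symmetric])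
next
  case (alpha_trans L M N)
  show ?case by (rule trans[OF alpha_trans.IH])
next
  case (alpha_app M M' N N')
  show ?case by (rule ext) (simp only: sem_raw.simps alpha_app.IH)
next
  case (alpha_lam M M' x)
  show ?case by (rule ext) (simp only: sem_raw.simps alpha_lam.IH)
qed

lift_definition sem :: "trm \<Rightarrow> env \<Rightarrow> prime set" ("\<lbrakk>_\<rbrakk>") is sem_raw
  by (rule sem_raw_alpha)

end

theory Submission
  imports Defs
begin

text \<open>The unfolding tree of \<open>\<sigma> \<star> \<tau>\<close> is the star of the trees of \<open>\<sigma>\<close> and \<open>\<tau>\<close>, and the constructions
  on prime systems commute with the union of the approximating chain, so \<open>Pty (\<sigma> \<star> \<tau>)\<close> is the
  corresponding sum, product or function space. A term of type \<open>\<sigma>\<close> therefore denotes an element of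
  \<open>D \<sigma>\<close>, and \<open>fapp (Pr A f) d = f d\<close> whenever \<open>f\<close> is continuous and \<open>d\<close> an element: this yields every
  reduction rule on well-typed redexes. The only rule needing more is the one for \<open>PCase\<close> at a
  function type, where \<open>fapp\<close> has to preserve intersections. Since injectivity of \<open>\<star>\<close> up to
  \<open>\<approx>\<close> gives subject reduction, all terms of a reduction sequence are typed as soon as the first
  one is.\<close>

section \<open>Type trees\<close>

text \<open>The conversion rule for \<open>\<approx>\<close> is the obstacle on both sides.
  Semantically it is harmless: \<open>D \<sigma>\<close> depends on \<open>tree \<sigma>\<close>
  alone and all primes live in one datatype, so passing to an equivalent type, or splitting
  \<open>Pty (ty_star s \<sigma> \<tau>)\<close>, is an equality rather than an isomorphism.
  Syntactically it blocks inversion of \<open>has_type\<close>; the syntax-directed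
  \<open>raw_type\<close>, with conversion built into variables, constants and abstractions,
  restores it. The freely chosen indices in the reduction rules are then forced by typing to agree
  up to \<open>\<approx>\<close>. Typing also matters for the equations themselves:
  \<open>fapp (Pr A f) d = f d\<close> is available for \<open>d\<close> in
  \<open>elements A\<close>, and \<open>sem_D\<close> supplies this. Continuity is expressed by
  finite supports (\<open>finitary\<close>), which yield monotonicity as well. A support is any
  finite set, whereas a \<open>Step\<close> prime is indexed by an antichain;
  \<open>antichain_cover\<close> bridges this gap.\<close>

lemma tle_refl: "simple \<sigma> \<Longrightarrow> \<sigma> \<preceq> \<sigma>"
  by (induction rule: simple.induct) (auto intro: tle.intros)

lemma tle_trans: "\<sigma> \<preceq> \<tau> \<Longrightarrow> \<tau> \<preceq> \<rho> \<Longrightarrow> \<sigma> \<preceq> \<rho>"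
proof (induction arbitrary: \<rho> rule: tle.induct)
  case (2 \<sigma> \<sigma>' \<tau> \<tau>' s)
  from \<open>Star s \<sigma>' \<tau>' \<preceq> \<rho>\<close> show ?case
    by cases (auto intro!: tle.intros 2)
qed (auto intro: tle.intros)

lemma tle_simple: "\<sigma> \<preceq> \<tau> \<Longrightarrow> simple \<sigma>"
  by (induction rule: tle.induct) (auto intro: simple.intros)

lemma tle_unfold: "\<sigma> \<preceq> \<tau> \<Longrightarrow> \<tau> \<rhd> \<tau>' \<Longrightarrow> \<sigma> \<preceq> \<tau>'"
proof (induction arbitrary: \<tau>' rule: tle.induct)
  case (2 \<sigma> \<sigma>' \<tau> \<tau>' s)
  from "2.prems" show ?case
    by cases (auto intro!: tle.intros 2)
qed (auto intro: tle.intros)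

lemma tle_unfolds: "(\<rhd>)\<^sup>*\<^sup>* \<tau> \<tau>' \<Longrightarrow> \<sigma> \<preceq> \<tau> \<Longrightarrow> \<sigma> \<preceq> \<tau>'"
  by (induction rule: rtranclp_induct) (auto intro: tle_unfold)

text \<open>\<open>\<tau>\<close> itself cannot serve as the bound, since it may contain
  \<open>Mu\<close> and so need not be simple; the bound is assembled componentwise below
  it.\<close>

lemma tle_upper_bound:
  "\<sigma> \<preceq> \<tau> \<Longrightarrow> \<sigma>' \<preceq> \<tau> \<Longrightarrow> \<exists>\<rho>. \<rho> \<preceq> \<tau> \<and> \<sigma> \<preceq> \<rho> \<and> \<sigma>' \<preceq> \<rho>"
proof (induction arbitrary: \<sigma>' rule: tle.induct)
  case (1 \<tau>)
  thus ?case by (meson tle.intros(1) tle_refl tle_simple)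
next
  case (2 \<sigma>1 \<tau>1 \<sigma>2 \<tau>2 s)
  from \<open>\<sigma>' \<preceq> _\<close> show ?case
  proof cases
    case 1
    have "Star s \<sigma>1 \<sigma>2 \<preceq> Star s \<tau>1 \<tau>2" using 2 by (auto intro: tle.intros)
    moreover have "Star s \<sigma>1 \<sigma>2 \<preceq> Star s \<sigma>1 \<sigma>2" by (rule tle_refl[OF tle_simple[OF calculation]])
    ultimately show ?thesis using 1 by (auto intro: tle.intros)
  next
    case (2 \<sigma>1' \<sigma>2')
    obtain \<rho>1 \<rho>2 where "\<rho>1 \<preceq> \<tau>1" "\<sigma>1 \<preceq> \<rho>1" "\<sigma>1' \<preceq> \<rho>1" "\<rho>2 \<preceq> \<tau>2" "\<sigma>2 \<preceq> \<rho>2" "\<sigma>2' \<preceq> \<rho>2"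
      using "2.IH" 2 by meson
    hence "Star s \<rho>1 \<rho>2 \<preceq> Star s \<tau>1 \<tau>2" "Star s \<sigma>1 \<sigma>2 \<preceq> Star s \<rho>1 \<rho>2"
      "Star s \<sigma>1' \<sigma>2' \<preceq> Star s \<rho>1 \<rho>2"
      by (auto intro: tle.intros tle_simple)
    thus ?thesis using 2 by blast
  qed
qed

text \<open>Unfolding never goes below a \<open>Mu\<close>, so redexes do not nest: two distinct
  ones lie in different arguments of some \<open>Star\<close> and can be unfolded in either order,
  one step each.\<close>

lemma unfold_diamond: "\<tau> \<rhd> \<tau>1 \<Longrightarrow> \<tau> \<rhd> \<tau>2 \<Longrightarrow> \<tau>1 = \<tau>2 \<or> (\<exists>\<tau>'. \<tau>1 \<rhd> \<tau>' \<and> \<tau>2 \<rhd> \<tau>')"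
proof (induction arbitrary: \<tau>2 rule: unfold.induct)
  case (1 t \<tau>)
  thus ?case by (auto elim: unfold.cases)
next
  case (2 \<sigma> \<sigma>' s \<tau>)
  from \<open>Star s \<sigma> \<tau> \<rhd> \<tau>2\<close> show ?case
    by cases (use 2 in \<open>blast intro: unfold.intros\<close>)+
next
  case (3 \<tau> \<tau>' s \<sigma>)
  from \<open>Star s \<sigma> \<tau> \<rhd> \<tau>2\<close> show ?case
    by cases (use 3 in \<open>blast intro: unfold.intros\<close>)+
qed

lemma unfolds_confluent:
  assumes "(\<rhd>)\<^sup>*\<^sup>* \<tau> \<tau>1" "(\<rhd>)\<^sup>*\<^sup>* \<tau> \<tau>2"
  shows "\<exists>\<tau>'. (\<rhd>)\<^sup>*\<^sup>* \<tau>1 \<tau>' \<and> (\<rhd>)\<^sup>*\<^sup>* \<tau>2 \<tau>'"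
proof -
  \<comment> \<open>The single step remains at most one step after crossing a whole sequence, so the
    steps of the other sequence can be absorbed one by one.\<close>
  have strip: "\<exists>\<tau>'. (\<rhd>)\<^sup>*\<^sup>* \<tau>1 \<tau>' \<and> (\<rhd>)\<^sup>=\<^sup>= \<tau>2 \<tau>'" if "(\<rhd>)\<^sup>*\<^sup>* \<tau> \<tau>2" "\<tau> \<rhd> \<tau>1" for \<tau> \<tau>1 \<tau>2
    using that
  proof (induction rule: rtranclp_induct)
    case base
    thus ?case by auto
  next
    case (step \<tau>2 \<tau>3)
    then obtain \<tau>' where 1: "(\<rhd>)\<^sup>*\<^sup>* \<tau>1 \<tau>'" "\<tau>2 \<rhd> \<tau>' \<or> \<tau>2 = \<tau>'" by auto
    from 1(2) unfold_diamond[OF step(2)] step(2)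
    have "\<exists>\<tau>''. (\<rhd>)\<^sup>*\<^sup>* \<tau>' \<tau>'' \<and> (\<rhd>)\<^sup>=\<^sup>= \<tau>3 \<tau>''" by blast
    thus ?case using 1(1) by (meson rtranclp_trans)
  qed
  from assms show ?thesis
  proof (induction arbitrary: \<tau>2 rule: converse_rtranclp_induct)
    case (step \<tau> \<tau>')
    then obtain \<rho> where 1: "(\<rhd>)\<^sup>*\<^sup>* \<tau>' \<rho>" "(\<rhd>)\<^sup>=\<^sup>= \<tau>2 \<rho>" using strip by blast
    hence "(\<rhd>)\<^sup>*\<^sup>* \<tau>2 \<rho>" by auto
    with step.IH[OF 1(1)] show ?case by (meson rtranclp_trans)
  qed auto
qed

text \<open>Directedness: approximations of two unfoldings both approximate a common unfolding, by
  confluence, and below it they have an upper bound. The recursion equations for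
  \<open>Papprox\<close> and the injectivity of \<open>tree_star\<close> are stated for type
  trees.\<close>

lemma type_tree_unfolding_tree: "type_tree (unfolding_tree \<tau>)"
  unfolding type_tree_def
proof (intro conjI ballI allI impI)
  show "unfolding_tree \<tau> \<noteq> {}"
    by (auto simp: unfolding_tree_def intro: simple.intros tle.intros)
next
  fix \<sigma>1 \<sigma>2 assume "\<sigma>1 \<in> unfolding_tree \<tau>" "\<sigma>2 \<in> unfolding_tree \<tau>"
  then obtain \<tau>1 \<tau>2 where 1: "(\<rhd>)\<^sup>*\<^sup>* \<tau> \<tau>1" "\<sigma>1 \<preceq> \<tau>1" "(\<rhd>)\<^sup>*\<^sup>* \<tau> \<tau>2" "\<sigma>2 \<preceq> \<tau>2"
    by (auto simp: unfolding_tree_def)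
  obtain \<tau>' where 2: "(\<rhd>)\<^sup>*\<^sup>* \<tau>1 \<tau>'" "(\<rhd>)\<^sup>*\<^sup>* \<tau>2 \<tau>'"
    using unfolds_confluent[OF 1(1,3)] by blast
  obtain \<rho> where "\<rho> \<preceq> \<tau>'" "\<sigma>1 \<preceq> \<rho>" "\<sigma>2 \<preceq> \<rho>"
    using tle_upper_bound[OF tle_unfolds[OF 2(1) 1(2)] tle_unfolds[OF 2(2) 1(4)]] by blast
  moreover have "(\<rhd>)\<^sup>*\<^sup>* \<tau> \<tau>'" using 1(1) 2(1) by (rule rtranclp_trans)
  ultimately show "\<exists>\<rho>\<in>unfolding_tree \<tau>. \<sigma>1 \<preceq> \<rho> \<and> \<sigma>2 \<preceq> \<rho>"
    by (auto simp: unfolding_tree_def intro: tle_simple)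
qed (auto simp: unfolding_tree_def intro: tle_simple tle_trans)

lemma unfolds_Star:
  "(\<rhd>)\<^sup>*\<^sup>* (Star s \<sigma> \<tau>) \<rho> \<longleftrightarrow> (\<exists>\<sigma>' \<tau>'. \<rho> = Star s \<sigma>' \<tau>' \<and> (\<rhd>)\<^sup>*\<^sup>* \<sigma> \<sigma>' \<and> (\<rhd>)\<^sup>*\<^sup>* \<tau> \<tau>')"
    (is "?L \<longleftrightarrow> ?R")
proof
  assume ?L
  thus ?R
  proof (induction rule: rtranclp_induct)
    case (step \<rho> \<rho>')
    then obtain \<sigma>' \<tau>' where 1: "\<rho> = Star s \<sigma>' \<tau>'" "(\<rhd>)\<^sup>*\<^sup>* \<sigma> \<sigma>'" "(\<rhd>)\<^sup>*\<^sup>* \<tau> \<tau>'" by blast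
    from step(2)[unfolded 1(1)] show ?case
      by cases (use 1 in \<open>auto intro: rtranclp.intros\<close>)
  qed auto
next
  assume ?R
  then obtain \<sigma>' \<tau>' where 1: "\<rho> = Star s \<sigma>' \<tau>'" "(\<rhd>)\<^sup>*\<^sup>* \<sigma> \<sigma>'" "(\<rhd>)\<^sup>*\<^sup>* \<tau> \<tau>'" by blast
  from 1(2) have "(\<rhd>)\<^sup>*\<^sup>* (Star s \<sigma> \<tau>) (Star s \<sigma>' \<tau>)"
    by (induction rule: rtranclp_induct) (auto intro: rtranclp.intros unfold.intros)
  moreover from 1(3) have "(\<rhd>)\<^sup>*\<^sup>* (Star s \<sigma>' \<tau>) (Star s \<sigma>' \<tau>')"
    by (induction rule: rtranclp_induct) (auto intro: rtranclp.intros unfold.intros)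
  ultimately show ?L unfolding 1(1) by (rule rtranclp_trans)
qed

lemma unfolding_tree_Star:
  "unfolding_tree (Star s \<sigma> \<tau>) = tree_star s (unfolding_tree \<sigma>) (unfolding_tree \<tau>)"
proof (intro set_eqI iffI)
  fix \<rho> assume "\<rho> \<in> unfolding_tree (Star s \<sigma> \<tau>)"
  then obtain \<sigma>' \<tau>' where 1: "(\<rhd>)\<^sup>*\<^sup>* \<sigma> \<sigma>'" "(\<rhd>)\<^sup>*\<^sup>* \<tau> \<tau>'" "\<rho> \<preceq> Star s \<sigma>' \<tau>'"
    by (auto simp: unfolding_tree_def unfolds_Star)
  from 1(3) show "\<rho> \<in> tree_star s (unfolding_tree \<sigma>) (unfolding_tree \<tau>)"
    by cases (use 1 in \<open>auto simp: tree_star_def unfolding_tree_def\<close>)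
next
  fix \<rho> assume "\<rho> \<in> tree_star s (unfolding_tree \<sigma>) (unfolding_tree \<tau>)"
  thus "\<rho> \<in> unfolding_tree (Star s \<sigma> \<tau>)"
    unfolding tree_star_def unfolding_tree_def unfolds_Star
    by (auto intro: simple.intros tle.intros)
qed

lemma type_tree_tree: "type_tree (tree \<sigma>)"
  by transfer (rule type_tree_unfolding_tree)

lemma tree_ty_star: "tree (ty_star s \<sigma> \<tau>) = tree_star s (tree \<sigma>) (tree \<tau>)"
  by transfer (rule unfolding_tree_Star)

lemma ty_equiv_refl [simp]: "\<sigma> \<approx> \<sigma>"
  by (simp add: ty_equiv_def)

lemma ty_equiv_sym: "\<sigma> \<approx> \<tau> \<Longrightarrow> \<tau> \<approx> \<sigma>"
  by (simp add: ty_equiv_def)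

lemma ty_equiv_trans: "\<sigma> \<approx> \<tau> \<Longrightarrow> \<tau> \<approx> \<rho> \<Longrightarrow> \<sigma> \<approx> \<rho>"
  by (simp add: ty_equiv_def)

text \<open>Rests on trees being non-empty: membership in one component tree shows in the star only
  when paired with a member of the other.\<close>

lemma ty_equiv_star:
  "ty_star s \<sigma> \<tau> \<approx> ty_star s \<sigma>' \<tau>' \<longleftrightarrow> \<sigma> \<approx> \<sigma>' \<and> \<tau> \<approx> \<tau>'"
  unfolding ty_equiv_def tree_ty_star
  using tree_star_inject[OF type_tree_tree type_tree_tree type_tree_tree type_tree_tree,
      of s \<sigma> \<tau> s \<sigma>' \<tau>'] by auto


section \<open>Prime systems\<close>

text \<open>The axioms of a prime system with \<open>Le A\<close> a preorder, together with the
  condition that both relations live on \<open>Primes A\<close>, which the record type does not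
  enforce.\<close>

locale prime_presystem =
  fixes A :: psys
  assumes con_primes: "(a, b) \<in> Con A \<Longrightarrow> a \<in> Primes A \<and> b \<in> Primes A"
    and le_primes: "(a, b) \<in> Le A \<Longrightarrow> a \<in> Primes A \<and> b \<in> Primes A"
    and con_refl: "a \<in> Primes A \<Longrightarrow> (a, a) \<in> Con A"
    and con_sym: "(a, b) \<in> Con A \<Longrightarrow> (b, a) \<in> Con A"
    and le_refl: "a \<in> Primes A \<Longrightarrow> (a, a) \<in> Le A"
    and le_trans: "(a, b) \<in> Le A \<Longrightarrow> (b, c) \<in> Le A \<Longrightarrow> (a, c) \<in> Le A"
    and con_le: "(a, b) \<in> Con A \<Longrightarrow> (c, b) \<in> Le A \<Longrightarrow> (a, c) \<in> Con A"
begin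

lemma con_le2: "(a, b) \<in> Con A \<Longrightarrow> (c, a) \<in> Le A \<Longrightarrow> (d, b) \<in> Le A \<Longrightarrow> (c, d) \<in> Con A"
  by (meson con_le con_sym)

lemma subset_down: "X \<subseteq> Primes A \<Longrightarrow> X \<subseteq> down A X"
  by (auto simp: down_def intro: le_refl)

lemma down_subset: "d \<in> elements A \<Longrightarrow> X \<subseteq> d \<Longrightarrow> down A X \<subseteq> d"
  by (auto simp: down_def elements_def)

lemma down_mono: "X \<subseteq> down A Y \<Longrightarrow> down A X \<subseteq> down A Y"
  by (auto simp: down_def intro: le_trans)

lemma down_element:
  assumes "\<And>a b. a \<in> X \<Longrightarrow> b \<in> X \<Longrightarrow> (a, b) \<in> Con A"
  shows "down A X \<in> elements A"
  using assms le_primes by (auto simp: elements_def down_def intro: le_trans con_le2)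

lemma down_antichain: "X \<in> antichains A \<Longrightarrow> down A (fset X) \<in> elements A"
  by (rule down_element) (auto simp: antichains_def)

text \<open>A subset of least cardinality among those generating the same ideal is an antichain.\<close>

lemma antichain_cover:
  assumes "finite F" "F \<subseteq> d" "d \<in> elements A"
  obtains X where "X \<in> antichains A" "fset X \<subseteq> d" "F \<subseteq> down A (fset X)"
proof -
  have "F \<subseteq> Primes A" using assms by (auto simp: elements_def)
  define Q where "Q = (\<lambda>X. X \<subseteq> F \<and> F \<subseteq> down A X)"
  define X where "X = arg_min card Q"
  have "Q F" using subset_down[OF \<open>F \<subseteq> Primes A\<close>] by (simp add: Q_def)
  have X: "Q X" "\<And>Y. Q Y \<Longrightarrow> card X \<le> card Y"
    using arg_min_nat_lemma[of Q F card, OF \<open>Q F\<close>] by (auto simp: X_def)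
  have "finite X" using X(1) assms(1) by (auto simp: Q_def intro: finite_subset)
  have "(a, b) \<notin> Le A" if "a \<in> X" "b \<in> X" "a \<noteq> b" for a b
  proof
    assume "(a, b) \<in> Le A"
    have "down A X \<subseteq> down A (X - {a})"
    proof
      fix c assume "c \<in> down A X"
      then obtain x where "x \<in> X" "(c, x) \<in> Le A" by (auto simp: down_def)
      thus "c \<in> down A (X - {a})"
        using that \<open>(a, b) \<in> Le A\<close> by (cases "x = a") (auto simp: down_def intro: le_trans)
    qed
    hence "Q (X - {a})" using X(1) by (auto simp: Q_def)
    hence "card X \<le> card (X - {a})" by (rule X(2))
    moreover have "card (X - {a}) < card X" using \<open>finite X\<close> \<open>a \<in> X\<close> by (rule card_Diff1_less)
    ultimately show False by simp
  qed
  moreover have "X \<subseteq> d" using X(1) assms(2) by (auto simp: Q_def)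
  ultimately have "Abs_fset X \<in> antichains A"
    using \<open>finite X\<close> assms(3)
    by (simp add: antichains_def elements_def Abs_fset_inverse) blast
  thus thesis
    using \<open>finite X\<close> \<open>X \<subseteq> d\<close> X(1) by (intro that[of "Abs_fset X"]) (auto simp: Abs_fset_inverse Q_def)
qed

end

section \<open>Sums, products and function spaces of prime systems\<close>

lemma prime_presystem_pzero: "prime_presystem pzero"
  by unfold_locales (auto simp: pzero_def)

lemma Primes_psum [simp]:
  "Tag i \<in> Primes (psum A B) \<longleftrightarrow> i = 0 \<or> i = 1"
  "At i a \<in> Primes (psum A B) \<longleftrightarrow> i = 0 \<and> a \<in> Primes A \<or> i = 1 \<and> a \<in> Primes B"
  "Step X a \<notin> Primes (psum A B)"
  by (auto simp: psum_def summand_def)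

lemma Con_psum [simp]:
  "(Tag i, Tag j) \<in> Con (psum A B) \<longleftrightarrow> i = j \<and> (i = 0 \<or> i = 1)"
  "(Tag i, At j b) \<in> Con (psum A B) \<longleftrightarrow> i = j \<and> At j b \<in> Primes (psum A B)"
  "(At i a, Tag j) \<in> Con (psum A B) \<longleftrightarrow> i = j \<and> At i a \<in> Primes (psum A B)"
  "(At i a, At j b) \<in> Con (psum A B) \<longleftrightarrow> i = j \<and> At i a \<in> Primes (psum A B) \<and>
     At j b \<in> Primes (psum A B) \<and> (i = 0 \<and> (a, b) \<in> Con A \<or> i = 1 \<and> (a, b) \<in> Con B)"
  "(Step X a, q) \<notin> Con (psum A B)" "(q, Step X a) \<notin> Con (psum A B)"
  by (auto simp: psum_def summand_def)

lemma Le_psum [simp]: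
  "(Tag i, Tag j) \<in> Le (psum A B) \<longleftrightarrow> i = j \<and> (i = 0 \<or> i = 1)"
  "(Tag i, At j b) \<in> Le (psum A B) \<longleftrightarrow> i = j \<and> At j b \<in> Primes (psum A B)"
  "(At i a, Tag j) \<notin> Le (psum A B)"
  "(At i a, At j b) \<in> Le (psum A B) \<longleftrightarrow>
     i = j \<and> (i = 0 \<and> (a, b) \<in> Le A \<or> i = 1 \<and> (a, b) \<in> Le B)"
  "(Step X a, q) \<notin> Le (psum A B)" "(q, Step X a) \<notin> Le (psum A B)"
  by (auto simp: psum_def summand_def)

lemma prime_presystem_psum:
  assumes "prime_presystem A" "prime_presystem B"
  shows "prime_presystem (psum A B)"
proof -
  interpret A: prime_presystem A by fact
  interpret B: prime_presystem B by fact
  show ?thesis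
  proof
    fix a b assume "(a, b) \<in> Con (psum A B)"
    thus "a \<in> Primes (psum A B) \<and> b \<in> Primes (psum A B)" "(b, a) \<in> Con (psum A B)"
      by (cases a; cases b; auto intro: A.con_sym B.con_sym)+
  next
    fix a b assume "(a, b) \<in> Le (psum A B)"
    thus "a \<in> Primes (psum A B) \<and> b \<in> Primes (psum A B)"
      by (cases a; cases b) (auto dest: A.le_primes B.le_primes)
  next
    fix a assume "a \<in> Primes (psum A B)"
    thus "(a, a) \<in> Con (psum A B)" "(a, a) \<in> Le (psum A B)"
      by (cases a; auto intro: A.con_refl B.con_refl A.le_refl B.le_refl)+
  next
    fix a b c assume "(a, b) \<in> Le (psum A B)" "(b, c) \<in> Le (psum A B)"
    thus "(a, c) \<in> Le (psum A B)"
      by (cases a; cases b; cases c)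
        (auto dest: A.le_primes B.le_primes intro: A.le_trans B.le_trans)
  next
    fix a b c assume "(a, b) \<in> Con (psum A B)" "(c, b) \<in> Le (psum A B)"
    thus "(a, c) \<in> Con (psum A B)"
      by (cases a; cases b; cases c)
        (auto dest: A.le_primes B.le_primes intro: A.con_le B.con_le)
  qed
qed

lemma Primes_pprod [simp]:
  "At i a \<in> Primes (pprod A B) \<longleftrightarrow> i = 0 \<and> a \<in> Primes A \<or> i = 1 \<and> a \<in> Primes B"
  "Tag i \<notin> Primes (pprod A B)" "Step X a \<notin> Primes (pprod A B)"
  by (auto simp: pprod_def)

lemma Con_pprod [simp]:
  "(At i a, At j b) \<in> Con (pprod A B) \<longleftrightarrow>
     At i a \<in> Primes (pprod A B) \<and> At j b \<in> Primes (pprod A B) \<and>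
     (i = j \<longrightarrow> i = 0 \<and> (a, b) \<in> Con A \<or> i = 1 \<and> (a, b) \<in> Con B)"
  "(Tag i, q) \<notin> Con (pprod A B)" "(q, Tag i) \<notin> Con (pprod A B)"
  "(Step X a, q) \<notin> Con (pprod A B)" "(q, Step X a) \<notin> Con (pprod A B)"
  by (auto simp: pprod_def)

lemma Le_pprod [simp]:
  "(At i a, At j b) \<in> Le (pprod A B) \<longleftrightarrow>
     i = j \<and> (i = 0 \<and> (a, b) \<in> Le A \<or> i = 1 \<and> (a, b) \<in> Le B)"
  "(Tag i, q) \<notin> Le (pprod A B)" "(q, Tag i) \<notin> Le (pprod A B)"
  "(Step X a, q) \<notin> Le (pprod A B)" "(q, Step X a) \<notin> Le (pprod A B)"
  by (auto simp: pprod_def)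

lemma prime_presystem_pprod:
  assumes "prime_presystem A" "prime_presystem B"
  shows "prime_presystem (pprod A B)"
proof -
  interpret A: prime_presystem A by fact
  interpret B: prime_presystem B by fact
  show ?thesis
  proof
    fix a b assume "(a, b) \<in> Con (pprod A B)"
    thus "a \<in> Primes (pprod A B) \<and> b \<in> Primes (pprod A B)" "(b, a) \<in> Con (pprod A B)"
      by (cases a; cases b; auto intro: A.con_sym B.con_sym)+
  next
    fix a b assume "(a, b) \<in> Le (pprod A B)"
    thus "a \<in> Primes (pprod A B) \<and> b \<in> Primes (pprod A B)"
      by (cases a; cases b) (auto dest: A.le_primes B.le_primes)
  next
    fix a assume "a \<in> Primes (pprod A B)"
    thus "(a, a) \<in> Con (pprod A B)" "(a, a) \<in> Le (pprod A B)"
      by (cases a; auto intro: A.con_refl B.con_refl A.le_refl B.le_refl)+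
  next
    fix a b c assume "(a, b) \<in> Le (pprod A B)" "(b, c) \<in> Le (pprod A B)"
    thus "(a, c) \<in> Le (pprod A B)"
      by (cases a; cases b; cases c) (auto intro: A.le_trans B.le_trans)
  next
    fix a b c assume "(a, b) \<in> Con (pprod A B)" "(c, b) \<in> Le (pprod A B)"
    thus "(a, c) \<in> Con (pprod A B)"
      by (cases a; cases b; cases c)
        (auto dest: A.le_primes B.le_primes intro: A.con_le B.con_le)
  qed
qed

lemma Primes_pfun [simp]:
  "Step X a \<in> Primes (pfun A B) \<longleftrightarrow> X \<in> antichains A \<and> a \<in> Primes B"
  "Tag i \<notin> Primes (pfun A B)" "At i a \<notin> Primes (pfun A B)"
  by (auto simp: pfun_def)

lemma Con_pfun [simp]:
  "(Step X a, Step Y b) \<in> Con (pfun A B) \<longleftrightarrow> X \<in> antichains A \<and> Y \<in> antichains A \<and>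
     a \<in> Primes B \<and> b \<in> Primes B \<and>
     ((\<forall>x\<in>fset X. \<forall>y\<in>fset Y. (x, y) \<in> Con A) \<longrightarrow> (a, b) \<in> Con B)"
  "(Tag i, q) \<notin> Con (pfun A B)" "(q, Tag i) \<notin> Con (pfun A B)"
  "(At i c, q) \<notin> Con (pfun A B)" "(q, At i c) \<notin> Con (pfun A B)"
  by (auto simp: pfun_def)

lemma Le_pfun [simp]:
  "(Step X a, Step Y b) \<in> Le (pfun A B) \<longleftrightarrow> X \<in> antichains A \<and> Y \<in> antichains A \<and>
     a \<in> Primes B \<and> b \<in> Primes B \<and> fset Y \<subseteq> down A (fset X) \<and> (a, b) \<in> Le B"
  "(Tag i, q) \<notin> Le (pfun A B)" "(q, Tag i) \<notin> Le (pfun A B)"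
  "(At i c, q) \<notin> Le (pfun A B)" "(q, At i c) \<notin> Le (pfun A B)"
  by (auto simp: pfun_def)

lemma prime_presystem_pfun:
  assumes "prime_presystem A" "prime_presystem B"
  shows "prime_presystem (pfun A B)"
proof -
  interpret A: prime_presystem A by fact
  interpret B: prime_presystem B by fact
  show ?thesis
  proof
    fix a b c assume "(a, b) \<in> Le (pfun A B)" "(b, c) \<in> Le (pfun A B)"
    then obtain X x Y y Z z where 1: "a = Step X x" "c = Step Z z"
      "X \<in> antichains A" "Z \<in> antichains A" "x \<in> Primes B" "z \<in> Primes B"
      "fset Y \<subseteq> down A (fset X)" "fset Z \<subseteq> down A (fset Y)" "(x, y) \<in> Le B" "(y, z) \<in> Le B"
      by (auto simp: pfun_def)
    have "fset Z \<subseteq> down A (fset X)" using A.down_mono[OF 1(7)] 1(8) by (rule order_trans[rotated])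
    moreover have "(x, z) \<in> Le B" using 1(9,10) by (rule B.le_trans)
    ultimately show "(a, c) \<in> Le (pfun A B)" using 1 by (auto simp: pfun_def)
  next
    fix a b c assume "(a, b) \<in> Con (pfun A B)" "(c, b) \<in> Le (pfun A B)"
    then obtain X x Y y Z z where 1: "a = Step X x" "b = Step Y y" "c = Step Z z"
      "X \<in> antichains A" "Z \<in> antichains A" "x \<in> Primes B" "z \<in> Primes B" "(z, y) \<in> Le B"
      "fset Y \<subseteq> down A (fset Z)"
      "(\<forall>u\<in>fset X. \<forall>v\<in>fset Y. (u, v) \<in> Con A) \<longrightarrow> (x, y) \<in> Con B"
      by (cases a; cases b; cases c) simp_all
    \<comment> \<open>Consistency with \<open>Z\<close> passes down to \<open>Y\<close>, which lies
      in the ideal of \<open>Z\<close>; so \<open>x\<close> and \<open>y\<close> are consistent, and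
      since \<open>z\<close> is below \<open>y\<close>, so are \<open>x\<close> and
      \<open>z\<close>.\<close>
    have "(x, z) \<in> Con B" if 2: "\<forall>u\<in>fset X. \<forall>w\<in>fset Z. (u, w) \<in> Con A"
    proof -
      have "(u, v) \<in> Con A" if "u \<in> fset X" "v \<in> fset Y" for u v
        using 1(9) 2 that by (auto simp: down_def dest!: subsetD intro: A.con_le)
      thus ?thesis using 1 by (auto intro: B.con_le)
    qed
    thus "(a, c) \<in> Con (pfun A B)" using 1 by (auto simp: pfun_def)
  next
    fix a assume "a \<in> Primes (pfun A B)"
    then obtain X x where "a = Step X x" "X \<in> antichains A" "x \<in> Primes B"
      by (auto simp: pfun_def)
    moreover from this have "fset X \<subseteq> down A (fset X)"
      by (intro A.subset_down) (auto simp: antichains_def)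
    ultimately show "(a, a) \<in> Le (pfun A B)"
      by (auto simp: pfun_def intro: B.le_refl)
  next
    fix a b assume "(a, b) \<in> Con (pfun A B)"
    thus "(b, a) \<in> Con (pfun A B)"
      by (cases a; cases b) (simp_all, blast intro: A.con_sym B.con_sym)
  qed (auto simp: pfun_def intro: B.con_refl)
qed

lemma prime_presystem_pstar:
  "prime_presystem A \<Longrightarrow> prime_presystem B \<Longrightarrow> prime_presystem (pstar s A B)"
  by (cases s) (simp_all add: prime_presystem_psum prime_presystem_pprod prime_presystem_pfun)

section \<open>The approximating chain and its union\<close>

text \<open>Whether and how \<open>U\<close> splits as a star is independent of the level, so one
  case distinction serves all \<open>n\<close>, and an induction can compare the levels
  \<open>n\<close> and \<open>Suc n\<close>.\<close>

lemma Papprox_Suc_cases: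
  obtains "\<And>n. Papprox (Suc n) U = pzero"
  | s S T where "\<And>n. Papprox (Suc n) U = pstar s (Papprox n S) (Papprox n T)"
proof (cases "\<exists>s S T. type_tree S \<and> type_tree T \<and> U = tree_star s S T")
  case True
  thus ?thesis using that(2) Papprox_star by blast
next
  case False
  hence "Papprox (Suc n) U = pzero" for n by (simp only: Papprox.simps if_False)
  thus ?thesis by (rule that(1))
qed

lemma prime_presystem_Papprox: "prime_presystem (Papprox n U)"
proof (induction n arbitrary: U)
  case (Suc n)
  show ?case
    by (cases U rule: Papprox_Suc_cases)
      (simp_all only: prime_presystem_pzero prime_presystem_pstar Suc)
qed (simp add: prime_presystem_pzero)

text \<open>Induced substructures rather than inclusions: \<open>pfun\<close> uses
  \<open>Con\<close> in a premise and, through \<open>antichains\<close>, the negation of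
  \<open>Le\<close>, so it does not preserve mere inclusion of relations.\<close>

definition subsystem :: "psys \<Rightarrow> psys \<Rightarrow> bool" where
  "subsystem A B \<longleftrightarrow> Primes A \<subseteq> Primes B \<and> Con A = Con B \<inter> Primes A \<times> Primes A \<and>
     Le A = Le B \<inter> Primes A \<times> Primes A"

lemma subsystemI:
  assumes "\<And>a. a \<in> Primes A \<Longrightarrow> a \<in> Primes B"
    and "\<And>a b. (a, b) \<in> Con A \<longleftrightarrow> (a, b) \<in> Con B \<and> a \<in> Primes A \<and> b \<in> Primes A"
    and "\<And>a b. (a, b) \<in> Le A \<longleftrightarrow> (a, b) \<in> Le B \<and> a \<in> Primes A \<and> b \<in> Primes A"
  shows "subsystem A B"
  unfolding subsystem_def using assms by auto

lemma subsystemD: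
  assumes "subsystem A B"
  shows "a \<in> Primes A \<Longrightarrow> a \<in> Primes B"
    and "(a, b) \<in> Con A \<longleftrightarrow> (a, b) \<in> Con B \<and> a \<in> Primes A \<and> b \<in> Primes A"
    and "(a, b) \<in> Le A \<longleftrightarrow> (a, b) \<in> Le B \<and> a \<in> Primes A \<and> b \<in> Primes A"
  using assms by (auto simp: subsystem_def)

lemma subsystem_trans: "subsystem A B \<Longrightarrow> subsystem B C \<Longrightarrow> subsystem A C"
  unfolding subsystem_def by blast

lemma subsystem_antichains:
  assumes "subsystem A B"
  shows "X \<in> antichains A \<longleftrightarrow> X \<in> antichains B \<and> fset X \<subseteq> Primes A"
  unfolding antichains_def using subsystemD[OF assms] by (simp add: subset_iff) blast

lemma subsystem_psum:
  assumes "subsystem A A'" "subsystem B B'"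
  shows "subsystem (psum A B) (psum A' B')"
proof (rule subsystemI)
  note A = subsystemD[OF assms(1)] and B = subsystemD[OF assms(2)]
  fix a b
  show "a \<in> Primes (psum A B) \<Longrightarrow> a \<in> Primes (psum A' B')"
    by (cases a) (auto intro: A(1) B(1))
  show "(a, b) \<in> Con (psum A B) \<longleftrightarrow>
      (a, b) \<in> Con (psum A' B') \<and> a \<in> Primes (psum A B) \<and> b \<in> Primes (psum A B)"
    by (cases a; cases b) (auto simp: A(2) B(2) intro: A(1) B(1))
  show "(a, b) \<in> Le (psum A B) \<longleftrightarrow>
      (a, b) \<in> Le (psum A' B') \<and> a \<in> Primes (psum A B) \<and> b \<in> Primes (psum A B)"
    by (cases a; cases b) (auto simp: A(3) B(3) intro: A(1) B(1))
qed

lemma subsystem_pprod: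
  assumes "subsystem A A'" "subsystem B B'"
  shows "subsystem (pprod A B) (pprod A' B')"
proof (rule subsystemI)
  note A = subsystemD[OF assms(1)] and B = subsystemD[OF assms(2)]
  fix a b
  show "a \<in> Primes (pprod A B) \<Longrightarrow> a \<in> Primes (pprod A' B')"
    by (cases a) (auto intro: A(1) B(1))
  show "(a, b) \<in> Con (pprod A B) \<longleftrightarrow>
      (a, b) \<in> Con (pprod A' B') \<and> a \<in> Primes (pprod A B) \<and> b \<in> Primes (pprod A B)"
    by (cases a; cases b) (auto simp: A(2) B(2) intro: A(1) B(1))
  show "(a, b) \<in> Le (pprod A B) \<longleftrightarrow>
      (a, b) \<in> Le (pprod A' B') \<and> a \<in> Primes (pprod A B) \<and> b \<in> Primes (pprod A B)"
    by (cases a; cases b) (auto simp: A(3) B(3) intro: A(1) B(1))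
qed

lemma subsystem_pfun:
  assumes "subsystem A A'" "subsystem B B'"
  shows "subsystem (pfun A B) (pfun A' B')"
proof (rule subsystemI)
  note A = subsystemD[OF assms(1)] and B = subsystemD[OF assms(2)]
  note ac = subsystem_antichains[OF assms(1)]
  have con: "(\<forall>x\<in>fset X. \<forall>y\<in>fset Y. (x, y) \<in> Con A) \<longleftrightarrow> (\<forall>x\<in>fset X. \<forall>y\<in>fset Y. (x, y) \<in> Con A')"
    if "fset X \<subseteq> Primes A" "fset Y \<subseteq> Primes A" for X Y
    using that by (auto simp: A(2))
  have le: "fset Y \<subseteq> down A (fset X) \<longleftrightarrow> fset Y \<subseteq> down A' (fset X)"
    if "fset X \<subseteq> Primes A" "fset Y \<subseteq> Primes A" for X Y
    using that by (auto simp: A(3) down_def subset_iff)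
  fix a b
  show "a \<in> Primes (pfun A B) \<Longrightarrow> a \<in> Primes (pfun A' B')"
    by (cases a) (auto simp: ac intro: B(1))
  show "(a, b) \<in> Con (pfun A B) \<longleftrightarrow>
      (a, b) \<in> Con (pfun A' B') \<and> a \<in> Primes (pfun A B) \<and> b \<in> Primes (pfun A B)"
  proof (cases "a \<in> Primes (pfun A B) \<and> b \<in> Primes (pfun A B)")
    case True
    then obtain X x Y y where "a = Step X x" "b = Step Y y" "X \<in> antichains A" "Y \<in> antichains A"
      "x \<in> Primes B" "y \<in> Primes B" by (cases a; cases b) auto
    moreover from this have "fset X \<subseteq> Primes A" "fset Y \<subseteq> Primes A" by (simp_all add: ac)
    ultimately show ?thesis by (simp add: con B(2) ac[THEN iffD1] B(1))
  next
    case False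
    thus ?thesis by (cases a; cases b) auto
  qed
  show "(a, b) \<in> Le (pfun A B) \<longleftrightarrow>
      (a, b) \<in> Le (pfun A' B') \<and> a \<in> Primes (pfun A B) \<and> b \<in> Primes (pfun A B)"
  proof (cases "a \<in> Primes (pfun A B) \<and> b \<in> Primes (pfun A B)")
    case True
    then obtain X x Y y where "a = Step X x" "b = Step Y y" "X \<in> antichains A" "Y \<in> antichains A"
      "x \<in> Primes B" "y \<in> Primes B" by (cases a; cases b) auto
    moreover from this have "fset X \<subseteq> Primes A" "fset Y \<subseteq> Primes A" by (simp_all add: ac)
    ultimately show ?thesis by (simp add: le B(3) ac[THEN iffD1] B(1))
  next
    case False
    thus ?thesis by (cases a; cases b) auto
  qed
qed

lemma subsystem_pstar:
  "subsystem A A' \<Longrightarrow> subsystem B B' \<Longrightarrow> subsystem (pstar s A B) (pstar s A' B')"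
  by (cases s) (simp_all add: subsystem_psum subsystem_pprod subsystem_pfun)

lemma subsystem_refl: "prime_presystem A \<Longrightarrow> subsystem A A"
  by (rule subsystemI) (auto dest: prime_presystem.con_primes prime_presystem.le_primes)

lemma subsystem_pzero: "subsystem pzero A"
  by (auto simp: subsystem_def pzero_def)

lemma subsystem_Papprox_Suc: "subsystem (Papprox n U) (Papprox (Suc n) U)"
proof (induction n arbitrary: U)
  case 0
  show ?case unfolding Papprox.simps(1) by (rule subsystem_pzero)
next
  case (Suc n)
  show ?case
    by (cases U rule: Papprox_Suc_cases)
      (simp_all only: subsystem_pzero subsystem_pstar Suc)
qed

lemma subsystem_Papprox: "m \<le> n \<Longrightarrow> subsystem (Papprox m U) (Papprox n U)"
proof (induction n rule: dec_induct)
  case base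
  show ?case by (rule subsystem_refl[OF prime_presystem_Papprox])
next
  case (step n)
  show ?case by (rule subsystem_trans[OF step.IH subsystem_Papprox_Suc])
qed

lemma P_simps:
  "Primes (P U) = (\<Union>n. Primes (Papprox n U))"
  "Con (P U) = (\<Union>n. Con (Papprox n U))"
  "Le (P U) = (\<Union>n. Le (Papprox n U))"
  by (simp_all add: P_def)

lemma Papprox_mono:
  assumes "m \<le> n"
  shows "Primes (Papprox m U) \<subseteq> Primes (Papprox n U)" "Con (Papprox m U) \<subseteq> Con (Papprox n U)"
    "Le (Papprox m U) \<subseteq> Le (Papprox n U)"
  using subsystem_Papprox[OF assms, of U] by (auto simp: subsystem_def)

text \<open>Two primes of level \<open>n\<close> related at some level \<open>m\<close> are related
  at the larger of the two levels, which restricts back to level \<open>n\<close>.\<close>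

lemma subsystem_Papprox_P: "subsystem (Papprox n U) (P U)"
proof -
  interpret prime_presystem "Papprox n U" by (rule prime_presystem_Papprox)
  have "(a, b) \<in> Con (Papprox n U)"
    if "a \<in> Primes (Papprox n U)" "b \<in> Primes (Papprox n U)" "(a, b) \<in> Con (Papprox m U)" for a b m
    using that subsystem_Papprox[of n "max m n" U] Papprox_mono(2)[of m "max m n" U]
    by (auto simp: subsystem_def)
  moreover have "(a, b) \<in> Le (Papprox n U)"
    if "a \<in> Primes (Papprox n U)" "b \<in> Primes (Papprox n U)" "(a, b) \<in> Le (Papprox m U)" for a b m
    using that subsystem_Papprox[of n "max m n" U] Papprox_mono(3)[of m "max m n" U]
    by (auto simp: subsystem_def)
  ultimately show ?thesis
    by (auto simp: subsystem_def P_simps dest: con_primes le_primes)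
qed

lemma prime_presystem_P: "prime_presystem (P U)"
proof -
  interpret A: prime_presystem "Papprox n U" for n by (rule prime_presystem_Papprox)
  show ?thesis
  proof
    fix a b c assume "(a, b) \<in> Le (P U)" "(b, c) \<in> Le (P U)"
    then obtain m n where "(a, b) \<in> Le (Papprox m U)" "(b, c) \<in> Le (Papprox n U)"
      by (auto simp: P_simps)
    hence "(a, b) \<in> Le (Papprox (max m n) U)" "(b, c) \<in> Le (Papprox (max m n) U)"
      using Papprox_mono(3)[of m "max m n" U] Papprox_mono(3)[of n "max m n" U] by auto
    thus "(a, c) \<in> Le (P U)" by (auto simp: P_simps dest: A.le_trans)
  next
    fix a b c assume "(a, b) \<in> Con (P U)" "(c, b) \<in> Le (P U)"
    then obtain m n where "(a, b) \<in> Con (Papprox m U)" "(c, b) \<in> Le (Papprox n U)"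
      by (auto simp: P_simps)
    hence "(a, b) \<in> Con (Papprox (max m n) U)" "(c, b) \<in> Le (Papprox (max m n) U)"
      using Papprox_mono(2)[of m "max m n" U] Papprox_mono(3)[of n "max m n" U] by auto
    thus "(a, c) \<in> Con (P U)" by (auto simp: P_simps dest: A.con_le)
  qed (auto simp: P_simps dest: A.con_primes A.le_primes A.con_sym intro: A.con_refl A.le_refl)
qed

text \<open>Levels increase, so finitely many primes are all present at one level. Needed for the
  finite index of a \<open>Step\<close> prime.\<close>

lemma finite_subset_Papprox:
  "finite F \<Longrightarrow> F \<subseteq> Primes (P U) \<Longrightarrow> \<exists>n. F \<subseteq> Primes (Papprox n U)"
proof (induction rule: finite_induct)
  case (insert a F)
  then obtain m n where "a \<in> Primes (Papprox m U)" "F \<subseteq> Primes (Papprox n U)"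
    by (auto simp: P_simps)
  thus ?case
    using Papprox_mono(1)[of m "max m n" U] Papprox_mono(1)[of n "max m n" U]
    by (intro exI[of _ "max m n"]) auto
qed simp

text \<open>A prime of a sum or product mentions at most one prime of a component.
  \<open>Step X b\<close> mentions finitely many, because \<open>X\<close> is finite, so one level
  again contains them all.\<close>

lemma prime_of_pstar_P:
  assumes "a \<in> Primes (pstar s (P S) (P T))"
  shows "\<exists>n. a \<in> Primes (pstar s (Papprox n S) (Papprox n T))"
proof (cases s)
  case Plus
  thus ?thesis using assms by (auto simp: psum_def summand_def P_simps)
next
  case Times
  thus ?thesis using assms by (auto simp: pprod_def P_simps)
next
  case Arrow
  with assms obtain X b where a: "a = Step X b" "X \<in> antichains (P S)" "b \<in> Primes (P T)"
    by (auto simp: pfun_def)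
  obtain m where m: "fset X \<subseteq> Primes (Papprox m S)"
    using finite_subset_Papprox[of "fset X" S] a(2) by (auto simp: antichains_def)
  obtain n where n: "b \<in> Primes (Papprox n T)" using a(3) by (auto simp: P_simps)
  have "fset X \<subseteq> Primes (Papprox (max m n) S)" "b \<in> Primes (Papprox (max m n) T)"
    using m n Papprox_mono(1)[of m "max m n" S] Papprox_mono(1)[of n "max m n" T] by auto
  thus ?thesis
    using a Arrow by (auto simp: pfun_def subsystem_antichains[OF subsystem_Papprox_P])
qed

text \<open>Both sides are limits of the same chain \<open>?A\<close>: every prime of either side
  occurs in some \<open>?A n\<close>, and each \<open>?A n\<close> is an induced subsystem of both.
  Any two primes occur together at one stage, which then decides their relations on both
  sides.\<close>

lemma P_tree_star:
  assumes "type_tree S" "type_tree T"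
  shows "P (tree_star s S T) = pstar s (P S) (P T)"
proof -
  let ?A = "\<lambda>n. pstar s (Papprox n S) (Papprox n T)" and ?B = "pstar s (P S) (P T)"
  have P0: "subsystem (?A n) (P (tree_star s S T))" for n
    using subsystem_Papprox_P[of "Suc n" "tree_star s S T"] unfolding Papprox_star[OF assms] .
  have sub: "subsystem (?A n) ?B" for n
    by (intro subsystem_pstar subsystem_Papprox_P)
  \<comment> \<open>The stages are shifted by one: stage \<open>Suc k\<close> of the star is
    \<open>?A k\<close>, and stage \<open>0\<close> contributes no primes.\<close>
  have Papprox0: "Papprox n (tree_star s S T) = (case n of 0 \<Rightarrow> pzero | Suc k \<Rightarrow> ?A k)" for n
    by (cases n) (simp_all only: Papprox.simps(1) Papprox_star[OF assms] nat.case)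
  interpret L: prime_presystem "P (tree_star s S T)" by (rule prime_presystem_P)
  interpret R: prime_presystem ?B by (intro prime_presystem_pstar prime_presystem_P)
  have ex_L: "\<exists>n. a \<in> Primes (?A n)" if "a \<in> Primes (P (tree_star s S T))" for a
    using that unfolding P_simps Papprox0 by (force simp: pzero_def split: nat.split_asm)
  have mono: "Primes (?A m) \<subseteq> Primes (?A n)" if "m \<le> n" for m n
    using subsystem_pstar[OF subsystem_Papprox subsystem_Papprox, OF that that]
    by (auto simp: subsystem_def)
  have ex2: "\<exists>n. a \<in> Primes (?A n) \<and> b \<in> Primes (?A n)"
    if "a \<in> Primes (?A k)" "b \<in> Primes (?A l)" for a b k l
    using that mono[of k "max k l"] mono[of l "max k l"] by (intro exI[of _ "max k l"]) auto
  have primes: "Primes (P (tree_star s S T)) = Primes ?B"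
    using subsystemD(1)[OF P0] subsystemD(1)[OF sub] ex_L prime_of_pstar_P[of _ s S T] by blast
  have ex: "\<exists>n. a \<in> Primes (?A n) \<and> b \<in> Primes (?A n)"
    if "a \<in> Primes ?B" "b \<in> Primes ?B" for a b
    using that prime_of_pstar_P[of _ s S T] ex2 by meson
  have "(a, b) \<in> Con (P (tree_star s S T)) \<longleftrightarrow> (a, b) \<in> Con ?B" for a b
  proof (cases "a \<in> Primes ?B \<and> b \<in> Primes ?B")
    case True
    then obtain n where "a \<in> Primes (?A n)" "b \<in> Primes (?A n)" using ex by blast
    thus ?thesis using subsystemD(2,3)[OF P0[of n]] subsystemD(2,3)[OF sub[of n]] by blast
  qed (auto dest: L.con_primes R.con_primes simp: primes)
  moreover have "(a, b) \<in> Le (P (tree_star s S T)) \<longleftrightarrow> (a, b) \<in> Le ?B" for a b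
  proof (cases "a \<in> Primes ?B \<and> b \<in> Primes ?B")
    case True
    then obtain n where "a \<in> Primes (?A n)" "b \<in> Primes (?A n)" using ex by blast
    thus ?thesis using subsystemD(2,3)[OF P0[of n]] subsystemD(2,3)[OF sub[of n]] by blast
  qed (auto dest: L.le_primes R.le_primes simp: primes)
  ultimately show ?thesis using primes by (intro psys.equality) auto
qed

lemma Pty_star: "Pty (ty_star s \<sigma> \<tau>) = pstar s (Pty \<sigma>) (Pty \<tau>)"
  by (simp add: tree_ty_star P_tree_star type_tree_tree)

lemma D_equiv: "\<sigma> \<approx> \<tau> \<Longrightarrow> D \<sigma> = D \<tau>"
  by (simp add: D_def ty_equiv_def)


section \<open>Elements and continuous functions\<close>

text \<open>Scott continuity in terms of primes: each prime of the value is secured by a finite part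
  of the argument. Letting \<open>d'\<close> range over all elements containing \<open>F\<close>,
  not only those inside \<open>d\<close>, builds in monotonicity.\<close>

definition finitary :: "psys \<Rightarrow> (prime set \<Rightarrow> prime set) \<Rightarrow> bool" where
  "finitary A f \<longleftrightarrow> (\<forall>d\<in>elements A. \<forall>a\<in>f d.
     \<exists>F. finite F \<and> F \<subseteq> d \<and> (\<forall>d'\<in>elements A. F \<subseteq> d' \<longrightarrow> a \<in> f d'))"

lemma finitaryI:
  assumes "\<And>d a. d \<in> elements A \<Longrightarrow> a \<in> f d \<Longrightarrow>
     \<exists>F. finite F \<and> F \<subseteq> d \<and> (\<forall>d'\<in>elements A. F \<subseteq> d' \<longrightarrow> a \<in> f d')"
  shows "finitary A f"
  using assms by (simp add: finitary_def)

text \<open>For operations where a prime of the value depends on at most one prime of the argument,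
  such as \<open>inj_el\<close>, \<open>pair_el\<close>, \<open>proj_el\<close>,
  \<open>pcase_el\<close>, and \<open>fapp\<close> as a function of its first argument.\<close>

lemma finitary_singleI:
  assumes "\<And>d a. d \<in> elements A \<Longrightarrow> a \<in> f d \<Longrightarrow>
     (\<exists>c\<in>d. \<forall>d'\<in>elements A. c \<in> d' \<longrightarrow> a \<in> f d') \<or> (\<forall>d'\<in>elements A. a \<in> f d')"
  shows "finitary A f"
proof (rule finitaryI)
  fix d a assume "d \<in> elements A" "a \<in> f d"
  from assms[OF this] show "\<exists>F. finite F \<and> F \<subseteq> d \<and> (\<forall>d'\<in>elements A. F \<subseteq> d' \<longrightarrow> a \<in> f d')"
  proof (elim disjE bexE)
    fix c assume "c \<in> d" "\<forall>d'\<in>elements A. c \<in> d' \<longrightarrow> a \<in> f d'"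
    thus ?thesis by (intro exI[of _ "{c}"]) auto
  next
    assume "\<forall>d'\<in>elements A. a \<in> f d'"
    thus ?thesis by (intro exI[of _ "{}"]) auto
  qed
qed

lemma finitaryE:
  assumes "finitary A f" "d \<in> elements A" "a \<in> f d"
  obtains F where "finite F" "F \<subseteq> d" "\<forall>d'\<in>elements A. F \<subseteq> d' \<longrightarrow> a \<in> f d'"
proof -
  have "\<exists>F. finite F \<and> F \<subseteq> d \<and> (\<forall>d'\<in>elements A. F \<subseteq> d' \<longrightarrow> a \<in> f d')"
    using assms by (simp add: finitary_def)
  thus thesis using that by (elim exE conjE)
qed

lemma finitary_mono:
  assumes "finitary A f" "d \<in> elements A" "d' \<in> elements A" "d \<subseteq> d'"
  shows "f d \<subseteq> f d'"
proof
  fix a assume "a \<in> f d"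
  with assms(1,2) show "a \<in> f d'"
    by (rule finitaryE) (use assms(3,4) in auto)
qed

lemma Step_in_Pr [simp]:
  "Step X a \<in> Pr A f \<longleftrightarrow> X \<in> antichains A \<and> a \<in> f (down A (fset X))"
  "Tag i \<notin> Pr A f" "At i a \<notin> Pr A f"
  by (auto simp: Pr_def)

lemma Pr_cong:
  assumes "prime_presystem A" "\<And>d. d \<in> elements A \<Longrightarrow> f d = g d"
  shows "Pr A f = Pr A g"
  using assms by (auto simp: Pr_def prime_presystem.down_antichain)

text \<open>From left to right this is monotonicity, as the ideal of an index inside
  \<open>d\<close> stays inside \<open>d\<close>. Conversely, the finite support of a prime is
  covered by an antichain inside \<open>d\<close>, and \<open>Pr\<close> records the prime at that
  antichain.\<close>

lemma fapp_Pr: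
  assumes "prime_presystem A" "finitary A f" "d \<in> elements A"
  shows "fapp (Pr A f) d = f d"
proof -
  interpret prime_presystem A by fact
  show ?thesis
  proof (intro set_eqI iffI)
    fix a assume "a \<in> fapp (Pr A f) d"
    then obtain X where "fset X \<subseteq> d" "X \<in> antichains A" "a \<in> f (down A (fset X))"
      by (auto simp: fapp_def)
    thus "a \<in> f d"
      using finitary_mono[OF assms(2) down_antichain assms(3) down_subset[OF assms(3)]] by blast
  next
    fix a assume "a \<in> f d"
    obtain F where F: "finite F" "F \<subseteq> d" "\<forall>d'\<in>elements A. F \<subseteq> d' \<longrightarrow> a \<in> f d'"
      using finitaryE[OF assms(2,3) \<open>a \<in> f d\<close>] .
    obtain X where X: "X \<in> antichains A" "fset X \<subseteq> d" "F \<subseteq> down A (fset X)"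
      using antichain_cover[OF F(1,2) assms(3)] .
    have "a \<in> f (down A (fset X))" using F(3) down_antichain[OF X(1)] X(3) by simp
    thus "a \<in> fapp (Pr A f) d" using X by (auto simp: fapp_def)
  qed
qed

text \<open>This handles currying: a prime \<open>Step Y b\<close> probes \<open>k d\<close> at the
  single argument generated by \<open>Y\<close>, so continuity in \<open>d\<close> for each fixed
  \<open>e\<close> is enough.\<close>

lemma finitary_Pr:
  assumes "prime_presystem B" "\<And>e. e \<in> elements B \<Longrightarrow> finitary A (\<lambda>d. k d e)"
  shows "finitary A (\<lambda>d. Pr B (k d))"
proof (rule finitaryI)
  fix d c assume d: "d \<in> elements A" and "c \<in> Pr B (k d)"
  then obtain Y b where c: "c = Step Y b" "Y \<in> antichains B" "b \<in> k d (down B (fset Y))"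
    by (cases c) auto
  have fin: "finitary A (\<lambda>d. k d (down B (fset Y)))"
    by (rule assms(2)[OF prime_presystem.down_antichain[OF assms(1) c(2)]])
  obtain F where "finite F" "F \<subseteq> d"
    "\<forall>d'\<in>elements A. F \<subseteq> d' \<longrightarrow> b \<in> k d' (down B (fset Y))"
    using finitaryE[OF fin d c(3)] .
  thus "\<exists>F. finite F \<and> F \<subseteq> d \<and> (\<forall>d'\<in>elements A. F \<subseteq> d' \<longrightarrow> c \<in> Pr B (k d'))"
    using c(1,2) by (intro exI[of _ F]) simp
qed

lemma elementsD:
  assumes "d \<in> elements A"
  shows "a \<in> d \<Longrightarrow> a \<in> Primes A" "b \<in> d \<Longrightarrow> (a, b) \<in> Le A \<Longrightarrow> a \<in> d"
    "a \<in> d \<Longrightarrow> b \<in> d \<Longrightarrow> (a, b) \<in> Con A"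
  using assms by (auto simp: elements_def)

lemma elementsI:
  assumes "\<And>a. a \<in> d \<Longrightarrow> a \<in> Primes A" "\<And>a b. b \<in> d \<Longrightarrow> (a, b) \<in> Le A \<Longrightarrow> a \<in> d"
    "\<And>a b. a \<in> d \<Longrightarrow> b \<in> d \<Longrightarrow> (a, b) \<in> Con A"
  shows "d \<in> elements A"
  using assms by (auto simp: elements_def)

lemma empty_element: "{} \<in> elements A"
  by (simp add: elements_def)

lemma Int_element: "d \<in> elements A \<Longrightarrow> e \<in> elements A \<Longrightarrow> d \<inter> e \<in> elements A"
  by (auto simp: elements_def)

lemma Pr_element:
  assumes "prime_presystem A" "finitary A f" "\<And>d. d \<in> elements A \<Longrightarrow> f d \<in> elements B"
  shows "Pr A f \<in> elements (pfun A B)"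
proof -
  interpret prime_presystem A by fact
  note mono = finitary_mono[OF assms(2) down_antichain]
  show ?thesis
  proof (rule elementsI)
    fix a assume "a \<in> Pr A f"
    thus "a \<in> Primes (pfun A B)"
      by (cases a) (auto dest: elementsD(1)[OF assms(3)[OF down_antichain]])
  next
    fix a b assume "b \<in> Pr A f" "(a, b) \<in> Le (pfun A B)"
    then obtain X x Y y where 1: "a = Step X x" "b = Step Y y" "X \<in> antichains A"
      "Y \<in> antichains A" "fset Y \<subseteq> down A (fset X)" "(x, y) \<in> Le B" "y \<in> f (down A (fset Y))"
      by (cases a; cases b) auto
    have "y \<in> f (down A (fset X))"
      using mono[OF 1(4) down_antichain[OF 1(3)] down_mono[OF 1(5)]] 1(7) by blast
    hence "x \<in> f (down A (fset X))"
      using elementsD(2)[OF assms(3)[OF down_antichain[OF 1(3)]]] 1(6) by blast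
    thus "a \<in> Pr A f" using 1 by simp
  next
    fix a b assume "a \<in> Pr A f" "b \<in> Pr A f"
    then obtain X x Y y where 1: "a = Step X x" "b = Step Y y" "X \<in> antichains A"
      "Y \<in> antichains A" "x \<in> f (down A (fset X))" "y \<in> f (down A (fset Y))"
      by (cases a; cases b) auto
    \<comment> \<open>Consistent \<open>X\<close> and \<open>Y\<close> together generate an element
      \<open>?d\<close>. By monotonicity \<open>x\<close> and \<open>y\<close> both belong to the
      value at \<open>?d\<close>, which is an element and hence pairwise consistent.\<close>
    have "(x, y) \<in> Con B" if "\<forall>u\<in>fset X. \<forall>v\<in>fset Y. (u, v) \<in> Con A"
    proof -
      let ?d = "down A (fset X \<union> fset Y)"
      have d: "?d \<in> elements A"
        using that 1(3,4) by (intro down_element) (auto simp: antichains_def intro: con_sym)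
      have "x \<in> f ?d" "y \<in> f ?d"
        using mono[OF 1(3) d] mono[OF 1(4) d] 1(5,6) by (auto simp: down_def)
      thus ?thesis by (rule elementsD(3)[OF assms(3)[OF d]])
    qed
    thus "(a, b) \<in> Con (pfun A B)"
      using 1 elementsD(1)[OF assms(3)[OF down_antichain]] by auto
  qed
qed

lemma fapp_element:
  assumes "prime_presystem A" "prime_presystem B" "r \<in> elements (pfun A B)" "d \<in> elements A"
  shows "fapp r d \<in> elements B"
proof -
  interpret prime_presystem A by fact
  note r = elementsD[OF assms(3)]
  show ?thesis
  proof (rule elementsI)
    fix a assume "a \<in> fapp r d"
    thus "a \<in> Primes B" by (auto simp: fapp_def dest: r(1))
  next
    fix a b assume "b \<in> fapp r d" "(a, b) \<in> Le B"
    then obtain X where X: "fset X \<subseteq> d" "Step X b \<in> r" by (auto simp: fapp_def)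
    hence "X \<in> antichains A" "b \<in> Primes B" using r(1) by fastforce+
    moreover have "fset X \<subseteq> down A (fset X)"
      using calculation by (intro subset_down) (auto simp: antichains_def)
    moreover have "a \<in> Primes B"
      using prime_presystem.le_primes[OF assms(2) \<open>(a, b) \<in> Le B\<close>] by simp
    \<comment> \<open>Keeping the index and lowering the value gives a smaller \<open>Step\<close>
      prime, as \<open>X\<close> lies in its own ideal.\<close>
    ultimately have "Step X a \<in> r" using r(2)[OF X(2)] \<open>(a, b) \<in> Le B\<close> by simp
    thus "a \<in> fapp r d" using X by (auto simp: fapp_def)
  next
    fix a b assume "a \<in> fapp r d" "b \<in> fapp r d"
    then obtain X Y where "fset X \<subseteq> d" "Step X a \<in> r" "fset Y \<subseteq> d" "Step Y b \<in> r"
      by (auto simp: fapp_def)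
    thus "(a, b) \<in> Con B"
      using r(3)[of "Step X a" "Step Y b"] elementsD(3)[OF assms(4)] by (simp add: subset_iff)
  qed
qed

text \<open>A prime may be witnessed in \<open>r\<close> and \<open>r'\<close> by different indices
  \<open>X\<close> and \<open>Y\<close>. Both lie inside \<open>d\<close>, so one antichain
  \<open>Z\<close> inside \<open>d\<close> covers both; \<open>Step Z a\<close> is below both
  witnesses and hence belongs to \<open>r\<close> and to \<open>r'\<close>.\<close>

lemma fapp_Int:
  assumes "prime_presystem A" "prime_presystem B"
    and "r \<in> elements (pfun A B)" "r' \<in> elements (pfun A B)" "d \<in> elements A"
  shows "fapp (r \<inter> r') d = fapp r d \<inter> fapp r' d"
proof -
  interpret A: prime_presystem A by fact
  interpret B: prime_presystem B by fact
  have "a \<in> fapp (r \<inter> r') d" if "a \<in> fapp r d" "a \<in> fapp r' d" for a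
  proof -
    obtain X Y where 1: "fset X \<subseteq> d" "Step X a \<in> r" "fset Y \<subseteq> d" "Step Y a \<in> r'"
      using \<open>a \<in> fapp r d\<close> \<open>a \<in> fapp r' d\<close> by (auto simp: fapp_def)
    obtain Z where Z: "Z \<in> antichains A" "fset Z \<subseteq> d" "fset X \<union> fset Y \<subseteq> down A (fset Z)"
      using A.antichain_cover[of "fset X \<union> fset Y" d] 1(1,3) assms(5) by auto
    have XY: "X \<in> antichains A" "Y \<in> antichains A" "a \<in> Primes B"
      using elementsD(1)[OF assms(3) 1(2)] elementsD(1)[OF assms(4) 1(4)] by auto
    have "(Step Z a, Step X a) \<in> Le (pfun A B)" "(Step Z a, Step Y a) \<in> Le (pfun A B)"
      using Z XY B.le_refl by auto
    hence "Step Z a \<in> r \<inter> r'"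
      using elementsD(2)[OF assms(3) 1(2)] elementsD(2)[OF assms(4) 1(4)] by blast
    thus ?thesis using Z(2) by (auto simp: fapp_def)
  qed
  thus ?thesis by (auto simp: fapp_def)
qed

section \<open>Elements of sums and products\<close>

lemma inj_el_mem [simp]:
  "Tag j \<in> inj_el i d \<longleftrightarrow> j = i" "At j a \<in> inj_el i d \<longleftrightarrow> j = i \<and> a \<in> d" "Step X a \<notin> inj_el i d"
  by (auto simp: inj_el_def)

lemma pair_el_mem [simp]:
  "Tag j \<notin> pair_el d e" "At j a \<in> pair_el d e \<longleftrightarrow> j = 0 \<and> a \<in> d \<or> j = 1 \<and> a \<in> e"
  "Step X a \<notin> pair_el d e"
  by (auto simp: pair_el_def)

lemma proj_el_mem [simp]: "a \<in> proj_el i d \<longleftrightarrow> At i a \<in> d"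
  by (simp add: proj_el_def)

lemma inj_el_element:
  shows "d \<in> elements A \<Longrightarrow> inj_el 0 d \<in> elements (psum A B)"
    and "d \<in> elements B \<Longrightarrow> inj_el 1 d \<in> elements (psum A B)"
proof -
  assume d: "d \<in> elements A"
  show "inj_el 0 d \<in> elements (psum A B)"
  proof (rule elementsI)
    fix a b
    show "a \<in> inj_el 0 d \<Longrightarrow> a \<in> Primes (psum A B)"
      by (cases a) (auto dest: elementsD(1)[OF d])
    show "b \<in> inj_el 0 d \<Longrightarrow> (a, b) \<in> Le (psum A B) \<Longrightarrow> a \<in> inj_el 0 d"
      by (cases a; cases b) (auto dest: elementsD(2)[OF d])
    show "a \<in> inj_el 0 d \<Longrightarrow> b \<in> inj_el 0 d \<Longrightarrow> (a, b) \<in> Con (psum A B)"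
      by (cases a; cases b) (auto dest: elementsD(1)[OF d] elementsD(3)[OF d])
  qed
next
  assume d: "d \<in> elements B"
  show "inj_el 1 d \<in> elements (psum A B)"
  proof (rule elementsI)
    fix a b
    show "a \<in> inj_el 1 d \<Longrightarrow> a \<in> Primes (psum A B)"
      by (cases a) (auto dest: elementsD(1)[OF d])
    show "b \<in> inj_el 1 d \<Longrightarrow> (a, b) \<in> Le (psum A B) \<Longrightarrow> a \<in> inj_el 1 d"
      by (cases a; cases b) (auto dest: elementsD(2)[OF d])
    show "a \<in> inj_el 1 d \<Longrightarrow> b \<in> inj_el 1 d \<Longrightarrow> (a, b) \<in> Con (psum A B)"
      by (cases a; cases b) (auto dest: elementsD(1)[OF d] elementsD(3)[OF d])
  qed
qed

text \<open>\<open>Tag i\<close> is consistent only with primes of summand \<open>i\<close>, so an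
  element containing it lies inside that summand.\<close>

lemma element_psum_Tag:
  assumes "d \<in> elements (psum A B)" "Tag i \<in> d"
  shows "d = inj_el i (proj_el i d)"
proof (rule set_eqI)
  fix a
  have "a \<in> d \<Longrightarrow> (a, Tag i) \<in> Con (psum A B)"
    using elementsD(3)[OF assms(1) _ assms(2)] .
  thus "a \<in> d \<longleftrightarrow> a \<in> inj_el i (proj_el i d)"
    using assms(2) by (cases a) auto
qed

text \<open>A non-empty element contains a tag, since \<open>Tag i\<close> lies below every
  \<open>At i a\<close>, and the tag decides the summand. The cases match those of
  \<open>case_el\<close> and \<open>pcase_el\<close>.\<close>

lemma elements_psum_cases:
  assumes "d \<in> elements (psum A B)"
  obtains "d = {}"
  | e where "e \<in> elements A" "d = inj_el 0 e"
  | e where "e \<in> elements B" "d = inj_el 1 e"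
proof -
  note d = elementsD[OF assms]
  have 0: "proj_el 0 d \<in> elements A"
  proof (rule elementsI)
    fix a b
    show "a \<in> proj_el 0 d \<Longrightarrow> a \<in> Primes A" using d(1)[of "At 0 a"] by auto
    show "b \<in> proj_el 0 d \<Longrightarrow> (a, b) \<in> Le A \<Longrightarrow> a \<in> proj_el 0 d"
      using d(2)[of "At 0 b" "At 0 a"] by auto
    show "a \<in> proj_el 0 d \<Longrightarrow> b \<in> proj_el 0 d \<Longrightarrow> (a, b) \<in> Con A"
      using d(3)[of "At 0 a" "At 0 b"] by auto
  qed
  have 1: "proj_el 1 d \<in> elements B"
  proof (rule elementsI)
    fix a b
    show "a \<in> proj_el 1 d \<Longrightarrow> a \<in> Primes B" using d(1)[of "At 1 a"] by auto
    show "b \<in> proj_el 1 d \<Longrightarrow> (a, b) \<in> Le B \<Longrightarrow> a \<in> proj_el 1 d"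
      using d(2)[of "At 1 b" "At 1 a"] by auto
    show "a \<in> proj_el 1 d \<Longrightarrow> b \<in> proj_el 1 d \<Longrightarrow> (a, b) \<in> Con B"
      using d(3)[of "At 1 a" "At 1 b"] by auto
  qed
  consider "d = {}" | "Tag 0 \<in> d" | "Tag 1 \<in> d"
  proof (cases "d = {}")
    case False
    then obtain a where a: "a \<in> d" by blast
    have "Tag 0 \<in> d \<or> Tag 1 \<in> d"
      using a d(1)[OF a] d(2)[OF a, of "Tag 0"] d(2)[OF a, of "Tag 1"] by (cases a) auto
    thus thesis using that by blast
  qed
  thus thesis
  proof cases
    case 1
    thus ?thesis by (rule that(1))
  next
    case 2
    thus ?thesis by (rule that(2)[OF 0 element_psum_Tag[OF assms]])
  next
    case 3
    thus ?thesis by (rule that(3)[OF 1 element_psum_Tag[OF assms]])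
  qed
qed

lemma pair_el_element:
  assumes "d \<in> elements A" "e \<in> elements B"
  shows "pair_el d e \<in> elements (pprod A B)"
proof (rule elementsI)
  note d = elementsD[OF assms(1)] and e = elementsD[OF assms(2)]
  fix a b
  show "a \<in> pair_el d e \<Longrightarrow> a \<in> Primes (pprod A B)"
    by (cases a) (auto dest: d(1) e(1))
  show "b \<in> pair_el d e \<Longrightarrow> (a, b) \<in> Le (pprod A B) \<Longrightarrow> a \<in> pair_el d e"
    by (cases a; cases b) (auto dest: d(2) e(2))
  show "a \<in> pair_el d e \<Longrightarrow> b \<in> pair_el d e \<Longrightarrow> (a, b) \<in> Con (pprod A B)"
    by (cases a; cases b) (auto dest: d(1,3) e(1,3))
qed

lemma proj_el_element:
  assumes "d \<in> elements (pprod A B)"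
  shows "proj_el 0 d \<in> elements A" "proj_el 1 d \<in> elements B"
proof -
  note d = elementsD[OF assms]
  show "proj_el 0 d \<in> elements A"
  proof (rule elementsI)
    fix a b
    show "a \<in> proj_el 0 d \<Longrightarrow> a \<in> Primes A" using d(1)[of "At 0 a"] by auto
    show "b \<in> proj_el 0 d \<Longrightarrow> (a, b) \<in> Le A \<Longrightarrow> a \<in> proj_el 0 d"
      using d(2)[of "At 0 b" "At 0 a"] by auto
    show "a \<in> proj_el 0 d \<Longrightarrow> b \<in> proj_el 0 d \<Longrightarrow> (a, b) \<in> Con A"
      using d(3)[of "At 0 a" "At 0 b"] by auto
  qed
  show "proj_el 1 d \<in> elements B"
  proof (rule elementsI)
    fix a b
    show "a \<in> proj_el 1 d \<Longrightarrow> a \<in> Primes B" using d(1)[of "At 1 a"] by auto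
    show "b \<in> proj_el 1 d \<Longrightarrow> (a, b) \<in> Le B \<Longrightarrow> a \<in> proj_el 1 d"
      using d(2)[of "At 1 b" "At 1 a"] by auto
    show "a \<in> proj_el 1 d \<Longrightarrow> b \<in> proj_el 1 d \<Longrightarrow> (a, b) \<in> Con B"
      using d(3)[of "At 1 a" "At 1 b"] by auto
  qed
qed

section \<open>Continuity of the semantic operations\<close>

lemma finitary_inj_el: "finitary A (inj_el i)"
  by (rule finitary_singleI) (unfold inj_el_def, blast)

lemma finitary_pair_el: "finitary A (\<lambda>d. pair_el d e)" "finitary A (\<lambda>e. pair_el d e)"
  unfolding pair_el_def by (rule finitary_singleI, blast)+

lemma finitary_proj_el: "finitary A (proj_el i)"
  by (rule finitary_singleI) (use proj_el_mem in blast)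

text \<open>On elements a single prime of the scrutinee selects the branch; in this form the choice
  has a finite witness.\<close>

lemma case_el_Tag:
  assumes "d \<in> elements (psum A B)"
  shows "Tag 0 \<in> d \<Longrightarrow> case_el d f g = fapp f (proj_el 0 d)"
    and "Tag 1 \<in> d \<Longrightarrow> case_el d f g = fapp g (proj_el 1 d)"
  by (rule trans[OF arg_cong[of _ _ "\<lambda>d. case_el d f g", OF element_psum_Tag[OF assms]]],
      assumption, rule case_el_eqs)+

lemma pcase_el_Tag:
  assumes "d \<in> elements (psum A B)"
  shows "Tag 0 \<in> d \<Longrightarrow> pcase_el d b c = b"
    and "Tag 1 \<in> d \<Longrightarrow> pcase_el d b c = c"
  by (rule trans[OF arg_cong[of _ _ "\<lambda>d. pcase_el d b c", OF element_psum_Tag[OF assms]]],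
      assumption, rule pcase_el_eqs)+

lemma finitary_id: "finitary A (\<lambda>d. d)"
  by (rule finitary_singleI) blast

lemma finitary_const: "finitary A (\<lambda>d. e)"
  by (rule finitary_singleI) blast

lemma finitary_Int_const: "finitary A (\<lambda>d. d \<inter> e)" "finitary A (\<lambda>d. e \<inter> d)"
  by (rule finitary_singleI, blast)+

lemma finitary_if: "finitary A f \<Longrightarrow> finitary A g \<Longrightarrow> finitary A (\<lambda>d. if b then f d else g d)"
  by (cases b) simp_all

lemma finitary_fapp: "finitary A (\<lambda>r. fapp r d)"
  by (rule finitary_singleI) (unfold fapp_def, blast)

text \<open>The support consists of the tag, which fixes the branch, and of the index
  \<open>X\<close> through which \<open>fapp\<close> obtained the prime;
  \<open>inj_el 0 (fset X)\<close> or \<open>inj_el 1 (fset X)\<close> packages both.\<close>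

lemma finitary_case_el: "finitary (psum A B) (\<lambda>d. case_el d f g)"
proof (rule finitaryI)
  fix d a assume d: "d \<in> elements (psum A B)" and a: "a \<in> case_el d f g"
  from d show "\<exists>F. finite F \<and> F \<subseteq> d \<and> (\<forall>d'\<in>elements (psum A B). F \<subseteq> d' \<longrightarrow> a \<in> case_el d' f g)"
  proof (cases rule: elements_psum_cases)
    case 1
    thus ?thesis using a by (simp add: case_el_eqs)
  next
    case (2 e)
    then obtain X where "fset X \<subseteq> e" "Step X a \<in> f"
      using a by (auto simp: case_el_eqs fapp_def)
    moreover from this have "a \<in> case_el d' f g"
      if "d' \<in> elements (psum A B)" "inj_el 0 (fset X) \<subseteq> d'" for d'
    proof -
      have "Tag 0 \<in> d'" "fset X \<subseteq> proj_el 0 d'" using that(2) by (auto simp: inj_el_def)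
      thus ?thesis
        using \<open>Step X a \<in> f\<close> case_el_Tag(1)[OF that(1), of f g] by (auto simp: fapp_def)
    qed
    ultimately show ?thesis
      using 2 by (intro exI[of _ "inj_el 0 (fset X)"]) (auto simp: inj_el_def)
  next
    case (3 e)
    then obtain X where "fset X \<subseteq> e" "Step X a \<in> g"
      using a by (auto simp: case_el_eqs[simplified] fapp_def)
    moreover from this have "a \<in> case_el d' f g"
      if "d' \<in> elements (psum A B)" "inj_el 1 (fset X) \<subseteq> d'" for d'
    proof -
      have "Tag 1 \<in> d'" "fset X \<subseteq> proj_el 1 d'" using that(2) by (auto simp: inj_el_def)
      thus ?thesis
        using \<open>Step X a \<in> g\<close> case_el_Tag(2)[OF that(1), of f g] by (auto simp: fapp_def)
    qed
    ultimately show ?thesis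
      using 3 by (intro exI[of _ "inj_el 1 (fset X)"]) (auto simp: inj_el_def)
  qed
qed

lemma finitary_case_el_branch: "finitary A (\<lambda>f. case_el d f g)" "finitary A (\<lambda>g. case_el d f g)"
  unfolding case_el_def by (intro finitary_if finitary_fapp finitary_const)+

lemma finitary_pcase_el: "finitary (psum A B) (\<lambda>a. pcase_el a b c)"
proof (rule finitary_singleI)
  fix d a assume d: "d \<in> elements (psum A B)" and a: "a \<in> pcase_el d b c"
  from d show "(\<exists>q\<in>d. \<forall>d'\<in>elements (psum A B). q \<in> d' \<longrightarrow> a \<in> pcase_el d' b c) \<or>
      (\<forall>d'\<in>elements (psum A B). a \<in> pcase_el d' b c)"
  proof (cases rule: elements_psum_cases)
    case 1
    \<comment> \<open>A prime common to both branches belongs to the value whatever the condition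
      is, so its support is empty.\<close>
    hence "a \<in> b" "a \<in> c" using a by (simp_all add: pcase_el_eqs)
    hence "a \<in> pcase_el d' b c" for d' by (simp add: pcase_el_def)
    thus ?thesis by blast
  next
    case (2 e)
    hence "Tag 0 \<in> d" "a \<in> b" using a pcase_el_Tag(1)[OF d, of b c] by simp_all
    thus ?thesis using pcase_el_Tag(1)[of _ A B b c] by blast
  next
    case (3 e)
    hence "Tag 1 \<in> d" "a \<in> c" using a pcase_el_Tag(2)[OF d, of b c] by simp_all
    thus ?thesis using pcase_el_Tag(2)[of _ A B b c] by blast
  qed
qed

lemma finitary_pcase_el_branch: "finitary A (\<lambda>b. pcase_el a b c)" "finitary A (\<lambda>c. pcase_el a b c)"
  unfolding pcase_el_def by (intro finitary_if finitary_id finitary_const finitary_Int_const)+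

lemma case_el_element:
  assumes "prime_presystem A" "prime_presystem B" "prime_presystem C" "d \<in> elements (psum A B)"
    "f \<in> elements (pfun A C)" "g \<in> elements (pfun B C)"
  shows "case_el d f g \<in> elements C"
  using assms(4)
proof (cases rule: elements_psum_cases)
  case 1
  thus ?thesis by (simp add: case_el_eqs empty_element)
next
  case (2 e)
  show ?thesis
    unfolding 2(2) case_el_eqs by (rule fapp_element[OF assms(1,3,5) 2(1)])
next
  case (3 e)
  show ?thesis
    unfolding 3(2) case_el_eqs by (rule fapp_element[OF assms(2,3,6) 3(1)])
qed

lemma pcase_el_element:
  assumes "b \<in> elements C" "c \<in> elements C"
  shows "pcase_el a b c \<in> elements C"
  using assms by (simp add: pcase_el_def Int_element)

section \<open>Typed domains and the denotations of constants\<close>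

lemmas D_star = D_def Pty_star pstar.simps

lemma Pr_D:
  assumes "finitary (Pty \<sigma>) f" "\<And>d. d \<in> D \<sigma> \<Longrightarrow> f d \<in> D \<tau>"
  shows "Pr (Pty \<sigma>) f \<in> D (\<sigma> \<Rrightarrow> \<tau>)"
  using assms unfolding D_star by (rule Pr_element[OF prime_presystem_P])

lemma fapp_D: "r \<in> D (\<sigma> \<Rrightarrow> \<tau>) \<Longrightarrow> d \<in> D \<sigma> \<Longrightarrow> fapp r d \<in> D \<tau>"
  unfolding D_star by (rule fapp_element[OF prime_presystem_P prime_presystem_P])

lemma fapp_Pr_D: "finitary (Pty \<sigma>) f \<Longrightarrow> d \<in> D \<sigma> \<Longrightarrow> fapp (Pr (Pty \<sigma>) f) d = f d"
  unfolding D_def by (rule fapp_Pr[OF prime_presystem_P])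

lemma fapp_Int_D:
  "r \<in> D (\<sigma> \<Rrightarrow> \<tau>) \<Longrightarrow> r' \<in> D (\<sigma> \<Rrightarrow> \<tau>) \<Longrightarrow> d \<in> D \<sigma> \<Longrightarrow>
     fapp (r \<inter> r') d = fapp r d \<inter> fapp r' d"
  unfolding D_star by (rule fapp_Int[OF prime_presystem_P prime_presystem_P])

lemma finitary_Pr_P:
  "(\<And>e. e \<in> D \<tau> \<Longrightarrow> finitary A (\<lambda>d. k d e)) \<Longrightarrow> finitary A (\<lambda>d. Pr (Pty \<tau>) (k d))"
  unfolding D_def by (rule finitary_Pr[OF prime_presystem_P])

lemma finitary_P_sum:
  "finitary (Pty (\<sigma> \<oplus> \<tau>)) (\<lambda>d. case_el d f g)" "finitary (Pty (\<sigma> \<oplus> \<tau>)) (\<lambda>d. pcase_el d b c)"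
  unfolding Pty_star pstar.simps by (rule finitary_case_el finitary_pcase_el)+

lemmas finitary_intros = finitary_Pr_P finitary_P_sum finitary_case_el_branch
  finitary_pcase_el_branch finitary_inj_el finitary_pair_el finitary_proj_el

lemma element_D:
  "d \<in> D \<sigma> \<Longrightarrow> inj_el 0 d \<in> D (\<sigma> \<oplus> \<tau>)"
  "d' \<in> D \<tau> \<Longrightarrow> inj_el 1 d' \<in> D (\<sigma> \<oplus> \<tau>)"
  "d \<in> D \<sigma> \<Longrightarrow> d' \<in> D \<tau> \<Longrightarrow> pair_el d d' \<in> D (\<sigma> \<otimes> \<tau>)"
  "p \<in> D (\<sigma> \<otimes> \<tau>) \<Longrightarrow> proj_el 0 p \<in> D \<sigma>"
  "p \<in> D (\<sigma> \<otimes> \<tau>) \<Longrightarrow> proj_el 1 p \<in> D \<tau>"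
  "s \<in> D (\<sigma> \<oplus> \<tau>) \<Longrightarrow> f \<in> D (\<sigma> \<Rrightarrow> \<rho>) \<Longrightarrow> g \<in> D (\<tau> \<Rrightarrow> \<rho>) \<Longrightarrow> case_el s f g \<in> D \<rho>"
  "b \<in> D \<rho> \<Longrightarrow> c \<in> D \<rho> \<Longrightarrow> pcase_el a b c \<in> D \<rho>"
  "{} \<in> D \<sigma>"
  unfolding D_star
  by (blast intro: inj_el_element pair_el_element proj_el_element pcase_el_element empty_element
      case_el_element[OF prime_presystem_P prime_presystem_P prime_presystem_P])+

lemma sem_const_D: "sem_const c \<in> D (ctype c)"
  by (cases c) (auto simp del: One_nat_def intro!: Pr_D finitary_intros element_D)

lemma sem_const_app:
  "d \<in> D \<sigma> \<Longrightarrow> fapp (sem_const (Inj0 \<sigma> \<tau>)) d = inj_el 0 d"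
  "d' \<in> D \<tau> \<Longrightarrow> fapp (sem_const (Inj1 \<sigma> \<tau>)) d' = inj_el 1 d'"
  "d \<in> D \<sigma> \<Longrightarrow> d' \<in> D \<tau> \<Longrightarrow> fapp (fapp (sem_const (Pair \<sigma> \<tau>)) d) d' = pair_el d d'"
  "p \<in> D (\<sigma> \<otimes> \<tau>) \<Longrightarrow> fapp (sem_const (Fst \<sigma> \<tau>)) p = proj_el 0 p"
  "p \<in> D (\<sigma> \<otimes> \<tau>) \<Longrightarrow> fapp (sem_const (Snd \<sigma> \<tau>)) p = proj_el 1 p"
  "s \<in> D (\<sigma> \<oplus> \<tau>) \<Longrightarrow> f \<in> D (\<sigma> \<Rrightarrow> \<rho>) \<Longrightarrow> g \<in> D (\<tau> \<Rrightarrow> \<rho>) \<Longrightarrow>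
     fapp (fapp (fapp (sem_const (Case \<sigma> \<tau> \<rho>)) s) f) g = case_el s f g"
  "s \<in> D (\<sigma> \<oplus> \<tau>) \<Longrightarrow> b \<in> D \<rho> \<Longrightarrow> c \<in> D \<rho> \<Longrightarrow>
     fapp (fapp (fapp (sem_const (PCase \<sigma> \<tau> \<rho>)) s) b) c = pcase_el s b c"
  by (simp_all add: fapp_Pr_D finitary_intros)


section \<open>Typing\<close>

text \<open>Syntax-directed typing: \<open>\<approx>\<close> enters where a type is read off, at
  variables, constants and abstractions; closure under conversion elsewhere is
  \<open>raw_type_equiv\<close>. Being recursive on raw terms, it gives inversion by
  simplification.\<close>

primrec raw_type :: "raw \<Rightarrow> ty \<Rightarrow> bool" where
  "raw_type (RVar x) \<sigma> \<longleftrightarrow> snd x \<approx> \<sigma>"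
| "raw_type (RConst c) \<sigma> \<longleftrightarrow> ctype c \<approx> \<sigma>"
| "raw_type (RApp M N) \<tau> \<longleftrightarrow> (\<exists>\<sigma>. raw_type M (\<sigma> \<Rrightarrow> \<tau>) \<and> raw_type N \<sigma>)"
| "raw_type (RLam x M) \<rho> \<longleftrightarrow> (\<exists>\<tau>. raw_type M \<tau> \<and> (snd x \<Rrightarrow> \<tau>) \<approx> \<rho>)"

lemma raw_type_equiv: "raw_type M \<sigma> \<Longrightarrow> \<sigma> \<approx> \<tau> \<Longrightarrow> raw_type M \<tau>"
proof (induction M arbitrary: \<sigma> \<tau>)
  case (RApp M N)
  then obtain \<rho> where "raw_type M (\<rho> \<Rrightarrow> \<sigma>)" "raw_type N \<rho>" by auto
  moreover from this RApp.IH(1)[of "\<rho> \<Rrightarrow> \<sigma>" "\<rho> \<Rrightarrow> \<tau>"] have "raw_type M (\<rho> \<Rrightarrow> \<tau>)"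
    using RApp.prems by (simp add: ty_equiv_star)
  ultimately show ?case by auto
qed (auto intro: ty_equiv_trans)

text \<open>Variables and constants carry their types; at an application, injectivity of
  \<open>\<Rrightarrow>\<close> up to \<open>\<approx>\<close> isolates the result type.\<close>

lemma raw_type_unique: "raw_type M \<sigma> \<Longrightarrow> raw_type M \<tau> \<Longrightarrow> \<sigma> \<approx> \<tau>"
proof (induction M arbitrary: \<sigma> \<tau>)
  case (RApp M N)
  then obtain \<rho> \<rho>' where "raw_type M (\<rho> \<Rrightarrow> \<sigma>)" "raw_type M (\<rho>' \<Rrightarrow> \<tau>)" by auto
  hence "\<rho> \<Rrightarrow> \<sigma> \<approx> \<rho>' \<Rrightarrow> \<tau>" by (rule RApp.IH)
  thus ?case by (simp add: ty_equiv_star)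
next
  case (RLam x M)
  then obtain \<rho> \<rho>' where "raw_type M \<rho>" "snd x \<Rrightarrow> \<rho> \<approx> \<sigma>" "raw_type M \<rho>'" "snd x \<Rrightarrow> \<rho>' \<approx> \<tau>"
    by auto
  moreover from this have "snd x \<Rrightarrow> \<rho> \<approx> snd x \<Rrightarrow> \<rho>'"
    by (simp add: ty_equiv_star RLam.IH)
  ultimately show ?case by (meson ty_equiv_sym ty_equiv_trans)
qed (auto intro: ty_equiv_sym ty_equiv_trans)

text \<open>An equivalence, because alpha-conversion must leave the set of types unchanged. At a
  variable, one direction is uniqueness of types and the other closure under conversion.\<close>

lemma raw_type_rsubst:
  assumes "\<And>y. y \<in> fv M \<Longrightarrow> raw_type (\<theta> y) (snd y)"
  shows "raw_type (rsubst M \<theta>) \<sigma> \<longleftrightarrow> raw_type M \<sigma>"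
  using assms
proof (induction M arbitrary: \<theta> \<sigma>)
  case (RVar x)
  hence "raw_type (\<theta> x) (snd x)" by simp
  thus ?case by (auto intro: raw_type_unique raw_type_equiv)
next
  case (RApp M N)
  have "raw_type (rsubst M \<theta>) \<tau> \<longleftrightarrow> raw_type M \<tau>" "raw_type (rsubst N \<theta>) \<tau> \<longleftrightarrow> raw_type N \<tau>" for \<tau>
    using RApp.prems by (auto intro!: RApp.IH)
  thus ?case by simp
next
  case (RLam x M)
  have "raw_type (rsubst M (\<theta>(x := RVar (fresh (snd x) V)))) \<tau> \<longleftrightarrow> raw_type M \<tau>" for V \<tau>
    using RLam.prems by (intro RLam.IH) (auto simp: snd_fresh)
  thus ?case by (simp add: Let_def snd_fresh)
qed auto

lemma raw_type_alpha: "alpha M N \<Longrightarrow> raw_type M = raw_type N"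
proof (induction rule: alpha.induct)
  case (alpha_rename y x M)
  have "raw_type (M[x :=\<^sub>r RVar y]) \<tau> \<longleftrightarrow> raw_type M \<tau>" for \<tau>
    by (rule raw_type_rsubst) (simp add: alpha_rename)
  thus ?case by (intro ext) (simp add: alpha_rename)
qed (auto intro!: ext)

lift_definition typed :: "trm \<Rightarrow> ty \<Rightarrow> bool" is raw_type
  by (rule raw_type_alpha)

lemma cls_simps:
  "cls (RVar x) = Var x" "cls (RConst c) = Const c" "cls (RApp M N) = cls M \<cdot> cls N"
  "cls (RLam x M) = Lam x (cls M)"
  by (transfer, rule alpha_refl)+

lemma cls_surj: obtains M where "t = cls M"
proof -
  have "\<exists>M. t = cls M" by transfer (blast intro: alpha_refl)
  thus thesis using that by blast
qed

lemma typed_cls: "typed (cls M) \<sigma> \<longleftrightarrow> raw_type M \<sigma>"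
  by transfer simp

lemma typed_simps:
  "typed (Var x) \<sigma> \<longleftrightarrow> snd x \<approx> \<sigma>"
  "typed (Const c) \<sigma> \<longleftrightarrow> ctype c \<approx> \<sigma>"
  "typed (M \<cdot> N) \<sigma> \<longleftrightarrow> (\<exists>\<tau>. typed M (\<tau> \<Rrightarrow> \<sigma>) \<and> typed N \<tau>)"
  "typed (Lam x M) \<sigma> \<longleftrightarrow> (\<exists>\<tau>. typed M \<tau> \<and> (snd x \<Rrightarrow> \<tau>) \<approx> \<sigma>)"
proof -
  obtain m n where "M = cls m" "N = cls n" by (metis cls_surj)
  thus "typed (Var x) \<sigma> \<longleftrightarrow> snd x \<approx> \<sigma>"
    "typed (Const c) \<sigma> \<longleftrightarrow> ctype c \<approx> \<sigma>"
    "typed (M \<cdot> N) \<sigma> \<longleftrightarrow> (\<exists>\<tau>. typed M (\<tau> \<Rrightarrow> \<sigma>) \<and> typed N \<tau>)"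
    "typed (Lam x M) \<sigma> \<longleftrightarrow> (\<exists>\<tau>. typed M \<tau> \<and> (snd x \<Rrightarrow> \<tau>) \<approx> \<sigma>)"
    by (simp_all add: typed_cls flip: cls_simps)
qed

lemma typed_equiv: "typed M \<sigma> \<Longrightarrow> \<sigma> \<approx> \<tau> \<Longrightarrow> typed M \<tau>"
  by transfer (rule raw_type_equiv)

lemma has_type_cls: "raw_type M \<sigma> \<Longrightarrow> cls M \<Colon> \<sigma>"
proof (induction M arbitrary: \<sigma>)
  case (RVar x)
  thus ?case using has_type.intros(2)[of "fst x" "snd x"]
    by (auto simp: cls_simps intro: has_type.intros(5))
next
  case (RLam x M)
  then obtain \<tau> where "cls M \<Colon> \<tau>" "snd x \<Rrightarrow> \<tau> \<approx> \<sigma>" by auto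
  thus ?case using has_type.intros(3)[of "cls M" \<tau> "fst x" "snd x"]
    by (auto simp: cls_simps intro: has_type.intros(5))
qed (auto simp: cls_simps intro: has_type.intros)

text \<open>Transfers the inversion principles of \<open>raw_type\<close> to the inductive typing of
  terms modulo alpha-conversion.\<close>

lemma has_type_iff_typed: "M \<Colon> \<sigma> \<longleftrightarrow> typed M \<sigma>"
proof
  show "M \<Colon> \<sigma> \<Longrightarrow> typed M \<sigma>"
    by (induction rule: has_type.induct) (auto simp: typed_simps intro: typed_equiv)
  show "typed M \<sigma> \<Longrightarrow> M \<Colon> \<sigma>"
    by (cases M rule: cls_surj) (simp add: typed_cls has_type_cls)
qed

section \<open>Inversion of typing for applied constants\<close>

lemma has_type_Const: "Const c \<Colon> \<sigma> \<longleftrightarrow> ctype c \<approx> \<sigma>"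
  and has_type_App: "M \<cdot> N \<Colon> \<sigma> \<longleftrightarrow> (\<exists>\<tau>. M \<Colon> \<tau> \<Rrightarrow> \<sigma> \<and> N \<Colon> \<tau>)"
  and has_type_Lam: "Lam x M \<Colon> \<sigma> \<longleftrightarrow> (\<exists>\<tau>. M \<Colon> \<tau> \<and> (snd x \<Rrightarrow> \<tau>) \<approx> \<sigma>)"
  by (simp_all add: has_type_iff_typed typed_simps)

lemma has_type_equiv: "\<sigma> \<approx> \<tau> \<Longrightarrow> M \<Colon> \<sigma> \<longleftrightarrow> M \<Colon> \<tau>"
  by (blast intro: has_type.intros(5) ty_equiv_sym)

text \<open>Peels one argument off a head with principal type
  \<open>\<pi> \<Rrightarrow> \<kappa>\<close>; \<open>C\<close> collects the typing conditions on
  the arguments so far, so iteration treats constants of any arity.\<close>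

lemma has_type_App_principal:
  assumes "\<And>\<sigma>. M \<Colon> \<sigma> \<longleftrightarrow> C \<and> \<pi> \<Rrightarrow> \<kappa> \<approx> \<sigma>"
  shows "M \<cdot> N \<Colon> \<sigma> \<longleftrightarrow> (C \<and> N \<Colon> \<pi>) \<and> \<kappa> \<approx> \<sigma>"
  unfolding has_type_App assms ty_equiv_star using has_type_equiv ty_equiv_refl by blast

lemma has_type_Const_App:
  assumes "ctype c = \<pi> \<Rrightarrow> \<kappa>"
  shows "Const c \<cdot> N \<Colon> \<sigma> \<longleftrightarrow> N \<Colon> \<pi> \<and> \<kappa> \<approx> \<sigma>"
  using has_type_App_principal[of "Const c" True \<pi> \<kappa>] by (simp add: has_type_Const assms)

lemma has_type_Inj:
  "Const (Inj0 \<sigma> \<tau>) \<cdot> x \<Colon> \<delta> \<longleftrightarrow> x \<Colon> \<sigma> \<and> \<sigma> \<oplus> \<tau> \<approx> \<delta>"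
  "Const (Inj1 \<sigma> \<tau>) \<cdot> x \<Colon> \<delta> \<longleftrightarrow> x \<Colon> \<tau> \<and> \<sigma> \<oplus> \<tau> \<approx> \<delta>"
  by (simp_all add: has_type_Const_App)

lemma has_type_proj:
  "Const (Fst \<sigma> \<tau>) \<cdot> x \<Colon> \<delta> \<longleftrightarrow> x \<Colon> \<sigma> \<otimes> \<tau> \<and> \<sigma> \<approx> \<delta>"
  "Const (Snd \<sigma> \<tau>) \<cdot> x \<Colon> \<delta> \<longleftrightarrow> x \<Colon> \<sigma> \<otimes> \<tau> \<and> \<tau> \<approx> \<delta>"
  by (simp_all add: has_type_Const_App)

lemma has_type_Pair:
  "Const (Pair \<sigma> \<tau>) \<cdot> x \<cdot> y \<Colon> \<delta> \<longleftrightarrow> x \<Colon> \<sigma> \<and> y \<Colon> \<tau> \<and> \<sigma> \<otimes> \<tau> \<approx> \<delta>"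
  by (subst has_type_App_principal[OF has_type_Const_App[OF ctype.simps(5)]]) simp

lemma has_type_Case:
  "Const (Case \<sigma> \<tau> \<rho>) \<cdot> x \<cdot> y \<cdot> z \<Colon> \<delta> \<longleftrightarrow>
     x \<Colon> \<sigma> \<oplus> \<tau> \<and> y \<Colon> \<sigma> \<Rrightarrow> \<rho> \<and> z \<Colon> \<tau> \<Rrightarrow> \<rho> \<and> \<rho> \<approx> \<delta>"
  by (subst has_type_App_principal[OF has_type_App_principal[OF has_type_Const_App[OF ctype.simps(3)]]])
    simp

lemma has_type_PCase:
  "Const (PCase \<sigma> \<tau> \<rho>) \<cdot> x \<cdot> y \<cdot> z \<Colon> \<delta> \<longleftrightarrow> x \<Colon> \<sigma> \<oplus> \<tau> \<and> y \<Colon> \<rho> \<and> z \<Colon> \<rho> \<and> \<rho> \<approx> \<delta>"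
  by (subst has_type_App_principal[OF has_type_App_principal[OF has_type_Const_App[OF ctype.simps(4)]]])
    simp


section \<open>Soundness\<close>

lemma sem_cls: "\<lbrakk>cls M\<rbrakk> = sem_raw M"
  by transfer simp

lemma sem_simps:
  "\<lbrakk>Var x\<rbrakk> \<epsilon> = \<epsilon> x" "\<lbrakk>Const c\<rbrakk> \<epsilon> = sem_const c" "\<lbrakk>M \<cdot> N\<rbrakk> \<epsilon> = fapp (\<lbrakk>M\<rbrakk> \<epsilon>) (\<lbrakk>N\<rbrakk> \<epsilon>)"
  "\<lbrakk>Lam x M\<rbrakk> \<epsilon> = Pr (Pty (snd x)) (\<lambda>d. \<lbrakk>M\<rbrakk> (\<epsilon>(x := d)))"
proof -
  obtain m n where "M = cls m" "N = cls n" by (metis cls_surj)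
  thus "\<lbrakk>Var x\<rbrakk> \<epsilon> = \<epsilon> x" "\<lbrakk>Const c\<rbrakk> \<epsilon> = sem_const c" "\<lbrakk>M \<cdot> N\<rbrakk> \<epsilon> = fapp (\<lbrakk>M\<rbrakk> \<epsilon>) (\<lbrakk>N\<rbrakk> \<epsilon>)"
    "\<lbrakk>Lam x M\<rbrakk> \<epsilon> = Pr (Pty (snd x)) (\<lambda>d. \<lbrakk>M\<rbrakk> (\<epsilon>(x := d)))"
    by (simp_all add: sem_cls flip: cls_simps)
qed

text \<open>This holds for untyped terms and arbitrary sets of primes as values, because \<open>Pr\<close> keeps only
  the values of a function at finitely generated arguments.\<close>

lemma sem_raw_finitary:
  assumes "a \<in> sem_raw M \<epsilon>"
  shows "\<exists>F\<le>\<epsilon>. (\<forall>x. finite (F x)) \<and> (\<forall>\<epsilon>'\<ge>F. a \<in> sem_raw M \<epsilon>')"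
  using assms
proof (induction M arbitrary: a \<epsilon>)
  case (RVar x)
  define F :: env where "F = (\<lambda>_. {})(x := {a})"
  have "F \<le> \<epsilon>" using RVar by (auto simp: F_def le_fun_def)
  moreover have "\<forall>y. finite (F y)" by (simp add: F_def)
  moreover have "a \<in> \<epsilon>' x" if "F \<le> \<epsilon>'" for \<epsilon>'
    using le_funD[OF that, of x] by (simp add: F_def)
  ultimately show ?case by (intro exI[of _ F]) simp
next
  case (RConst c)
  thus ?case by (intro exI[of _ "\<lambda>_. {}"]) (simp add: le_fun_def)
next
  case (RApp M N)
  then obtain X where X: "fset X \<subseteq> sem_raw N \<epsilon>" "Step X a \<in> sem_raw M \<epsilon>" by (auto simp: fapp_def)
  obtain F where F: "F \<le> \<epsilon>" "\<forall>x. finite (F x)" "\<forall>\<epsilon>'\<ge>F. Step X a \<in> sem_raw M \<epsilon>'"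
    using RApp.IH(1)[OF X(2)] by (elim exE conjE)
  \<comment> \<open>Each prime of the index \<open>X\<close> of the argument gets its own support;
    as \<open>X\<close> is finite, their union with the support \<open>F\<close> of the function
    part stays finite at every variable.\<close>
  have "\<forall>b\<in>fset X. \<exists>G\<le>\<epsilon>. (\<forall>x. finite (G x)) \<and> (\<forall>\<epsilon>'\<ge>G. b \<in> sem_raw N \<epsilon>')"
    by (intro ballI RApp.IH(2) subsetD[OF X(1)])
  from bchoice[OF this] obtain G where G: "\<forall>b\<in>fset X. G b \<le> \<epsilon> \<and> (\<forall>x. finite (G b x)) \<and>
    (\<forall>\<epsilon>'\<ge>G b. b \<in> sem_raw N \<epsilon>')" ..
  define H where "H x = F x \<union> (\<Union>b\<in>fset X. G b x)" for x
  have "H \<le> \<epsilon>"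
  proof (rule le_funI)
    fix x
    have "G b x \<subseteq> \<epsilon> x" if "b \<in> fset X" for b using G that by (simp add: le_funD)
    thus "H x \<le> \<epsilon> x" using le_funD[OF F(1), of x] by (simp add: H_def UN_least)
  qed
  moreover have "\<forall>x. finite (H x)" using F(2) G by (simp add: H_def)
  moreover have "a \<in> sem_raw (RApp M N) \<epsilon>'" if H: "H \<le> \<epsilon>'" for \<epsilon>'
  proof -
    have "F \<le> H" by (rule le_funI) (simp add: H_def)
    hence "Step X a \<in> sem_raw M \<epsilon>'" using F(3) H by simp
    moreover have "b \<in> sem_raw N \<epsilon>'" if "b \<in> fset X" for b
    proof -
      have "G b \<le> H" by (rule le_funI) (use that in \<open>auto simp: H_def\<close>)
      hence "G b \<le> \<epsilon>'" using H by (rule order_trans)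
      thus ?thesis using G that by simp
    qed
    ultimately show ?thesis by (auto simp: fapp_def)
  qed
  ultimately show ?case by (intro exI[of _ H]) simp
next
  case (RLam x M)
  \<comment> \<open>\<open>d\<close> is the argument at which \<open>Pr\<close> evaluates the body
    for the prime \<open>a\<close>. It is read off from \<open>a\<close> before \<open>a\<close> is
    known to be a \<open>Step\<close>, so that the update by \<open>d\<close> can be stated at
    once.\<close>
  define d where "d = down (Pty (snd x)) (fset (case a of Step X b \<Rightarrow> X))"
  obtain X b where X: "a = Step X b" "X \<in> antichains (Pty (snd x))" "b \<in> sem_raw M (\<epsilon>(x := d))"
    using RLam.prems by (cases a) (simp_all add: d_def)
  obtain F where F: "F \<le> \<epsilon>(x := d)" "\<forall>y. finite (F y)" "\<forall>\<epsilon>'\<ge>F. b \<in> sem_raw M \<epsilon>'"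
    using RLam.IH[OF X(3)] by (elim exE conjE)
  \<comment> \<open>The support at the bound variable is dropped: the body is always evaluated with
    \<open>d\<close> there, and \<open>d\<close> already contains \<open>F x\<close>.\<close>
  have "F(x := {}) \<le> \<epsilon>"
  proof (rule le_funI)
    fix y show "(F(x := {})) y \<le> \<epsilon> y" using le_funD[OF F(1), of y] by (cases "y = x") simp_all
  qed
  moreover have "finite ((F(x := {})) y)" for y using F(2)[rule_format, of y] by simp
  moreover have "a \<in> sem_raw (RLam x M) \<epsilon>'" if \<epsilon>': "F(x := {}) \<le> \<epsilon>'" for \<epsilon>'
  proof -
    have "F \<le> \<epsilon>'(x := d)"
    proof (rule le_funI)
      fix y show "F y \<le> (\<epsilon>'(x := d)) y"
        using le_funD[OF F(1), of y] le_funD[OF \<epsilon>', of y] by (cases "y = x") simp_all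
    qed
    hence "b \<in> sem_raw M (\<epsilon>'(x := d))" using F(3) by simp
    thus ?thesis using X(1,2) by (simp add: d_def)
  qed
  ultimately show ?case by (intro exI[of _ "F(x := {})"] conjI allI impI)
qed

text \<open>Only the component at \<open>x\<close> of the supporting environment constrains
  \<open>d'\<close>; the other components lie below \<open>\<epsilon>\<close> already.\<close>

lemma finitary_sem_raw: "finitary A (\<lambda>d. sem_raw M (\<epsilon>(x := d)))"
proof (rule finitaryI)
  fix d a assume "a \<in> sem_raw M (\<epsilon>(x := d))"
  from sem_raw_finitary[OF this] obtain F where F: "F \<le> \<epsilon>(x := d)" "\<forall>y. finite (F y)"
    "\<forall>\<epsilon>'\<ge>F. a \<in> sem_raw M \<epsilon>'" by (elim exE conjE)
  have "a \<in> sem_raw M (\<epsilon>(x := d'))" if "F x \<subseteq> d'" for d'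
  proof -
    have "F \<le> \<epsilon>(x := d')"
    proof (rule le_funI)
      fix y show "F y \<le> (\<epsilon>(x := d')) y" using le_funD[OF F(1), of y] that by (cases "y = x") simp_all
    qed
    thus ?thesis using F(3) by simp
  qed
  thus "\<exists>F. finite F \<and> F \<subseteq> d \<and> (\<forall>d'\<in>elements A. F \<subseteq> d' \<longrightarrow> a \<in> sem_raw M (\<epsilon>(x := d')))"
    using F(2)[rule_format, of x] le_funD[OF F(1), of x] by (intro exI[of _ "F x"]) simp
qed

lemma environment_upd: "environment \<epsilon> \<Longrightarrow> d \<in> D (snd x) \<Longrightarrow> environment (\<epsilon>(x := d))"
  by (auto simp: environment_def)

text \<open>Abstraction is where continuity of denotations enters; conversion is immediate, as
  equivalent types have the same domain.\<close>

lemma sem_D: "M \<Colon> \<sigma> \<Longrightarrow> environment \<epsilon> \<Longrightarrow> \<lbrakk>M\<rbrakk> \<epsilon> \<in> D \<sigma>"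
proof (induction arbitrary: \<epsilon> rule: has_type.induct)
  case (3 M \<tau> x \<sigma>)
  obtain m where "M = cls m" by (rule cls_surj)
  hence "finitary (Pty \<sigma>) (\<lambda>d. \<lbrakk>M\<rbrakk> (\<epsilon>((x, \<sigma>) := d)))"
    by (simp add: sem_cls finitary_sem_raw)
  thus ?case using 3 environment_upd[of \<epsilon> _ "(x, \<sigma>)"] by (auto simp: sem_simps intro!: Pr_D)
next
  case (5 M \<sigma> \<tau>)
  thus ?case using D_equiv by blast
qed (auto simp: sem_simps sem_const_D environment_def intro: fapp_D)

text \<open>When the condition selects no branch the value is an intersection, with which
  \<open>inj_el i\<close> commutes.\<close>

lemma pcase_el_inj:
  "pcase_el a (inj_el i b) (inj_el i c) = inj_el i (pcase_el a b c)"
  by (auto simp: pcase_el_def inj_el_def)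

lemma pcase_el_pair:
  "pcase_el a (pair_el b b') (pair_el c c') = pair_el (pcase_el a b c) (pcase_el a b' c')"
  by (auto simp: pcase_el_def pair_el_def)

lemma fapp_pcase_el:
  assumes "b \<in> D (\<sigma> \<Rrightarrow> \<tau>)" "c \<in> D (\<sigma> \<Rrightarrow> \<tau>)" "d \<in> D \<sigma>"
  shows "fapp (pcase_el a b c) d = pcase_el a (fapp b d) (fapp c d)"
  by (simp add: pcase_el_def fapp_Int_D[OF assms])

lemma sem_eval:
  "x \<Colon> \<sigma> \<Longrightarrow> environment \<epsilon> \<Longrightarrow> \<lbrakk>Const (Inj0 \<sigma> \<tau>) \<cdot> x\<rbrakk> \<epsilon> = inj_el 0 (\<lbrakk>x\<rbrakk> \<epsilon>)"
  "x \<Colon> \<tau> \<Longrightarrow> environment \<epsilon> \<Longrightarrow> \<lbrakk>Const (Inj1 \<sigma> \<tau>) \<cdot> x\<rbrakk> \<epsilon> = inj_el 1 (\<lbrakk>x\<rbrakk> \<epsilon>)"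
  "x \<Colon> \<sigma> \<Longrightarrow> y \<Colon> \<tau> \<Longrightarrow> environment \<epsilon> \<Longrightarrow>
     \<lbrakk>Const (Pair \<sigma> \<tau>) \<cdot> x \<cdot> y\<rbrakk> \<epsilon> = pair_el (\<lbrakk>x\<rbrakk> \<epsilon>) (\<lbrakk>y\<rbrakk> \<epsilon>)"
  "x \<Colon> \<sigma> \<otimes> \<tau> \<Longrightarrow> environment \<epsilon> \<Longrightarrow> \<lbrakk>Const (Fst \<sigma> \<tau>) \<cdot> x\<rbrakk> \<epsilon> = proj_el 0 (\<lbrakk>x\<rbrakk> \<epsilon>)"
  "x \<Colon> \<sigma> \<otimes> \<tau> \<Longrightarrow> environment \<epsilon> \<Longrightarrow> \<lbrakk>Const (Snd \<sigma> \<tau>) \<cdot> x\<rbrakk> \<epsilon> = proj_el 1 (\<lbrakk>x\<rbrakk> \<epsilon>)"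
  "x \<Colon> \<sigma> \<oplus> \<tau> \<Longrightarrow> y \<Colon> \<sigma> \<Rrightarrow> \<rho> \<Longrightarrow> z \<Colon> \<tau> \<Rrightarrow> \<rho> \<Longrightarrow> environment \<epsilon> \<Longrightarrow>
     \<lbrakk>Const (Case \<sigma> \<tau> \<rho>) \<cdot> x \<cdot> y \<cdot> z\<rbrakk> \<epsilon> = case_el (\<lbrakk>x\<rbrakk> \<epsilon>) (\<lbrakk>y\<rbrakk> \<epsilon>) (\<lbrakk>z\<rbrakk> \<epsilon>)"
  "x \<Colon> \<sigma> \<oplus> \<tau> \<Longrightarrow> y \<Colon> \<rho> \<Longrightarrow> z \<Colon> \<rho> \<Longrightarrow> environment \<epsilon> \<Longrightarrow>
     \<lbrakk>Const (PCase \<sigma> \<tau> \<rho>) \<cdot> x \<cdot> y \<cdot> z\<rbrakk> \<epsilon> = pcase_el (\<lbrakk>x\<rbrakk> \<epsilon>) (\<lbrakk>y\<rbrakk> \<epsilon>) (\<lbrakk>z\<rbrakk> \<epsilon>)"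
  unfolding sem_simps by (rule sem_const_app; erule (1) sem_D)+

text \<open>Both facts come from one induction, since the inversion that types the contractum also
  types the subterms whose denotations are evaluated. Keeping the same \<open>\<sigma>\<close> lets
  steps be chained.\<close>

lemma red_sound:
  "M \<leadsto> N \<Longrightarrow> M \<Colon> \<sigma> \<Longrightarrow> N \<Colon> \<sigma> \<and> (\<forall>\<epsilon>. environment \<epsilon> \<longrightarrow> \<lbrakk>M\<rbrakk> \<epsilon> = \<lbrakk>N\<rbrakk> \<epsilon>)"
proof (induction arbitrary: \<sigma> rule: red.induct)
  case (beta x M N)
  then obtain \<tau> \<rho> where 1: "cls M \<Colon> \<tau>" "snd x \<Rrightarrow> \<tau> \<approx> \<rho> \<Rrightarrow> \<sigma>" "cls N \<Colon> \<rho>"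
    by (auto simp: has_type_App has_type_Lam)
  \<comment> \<open>Injectivity of \<open>\<Rrightarrow>\<close> splits the equivalence: the
    argument receives the type of the bound variable and the body the type of the redex.\<close>
  hence M: "cls M \<Colon> \<sigma>" and N: "cls N \<Colon> snd x"
    by (auto simp: ty_equiv_star has_type_equiv)
  have "raw_type ((RVar(x := N)) y) (snd y)" for y
    using N by (simp add: has_type_iff_typed typed_cls)
  hence "cls (M[x :=\<^sub>r N]) \<Colon> \<sigma>"
    using M by (simp add: has_type_iff_typed typed_cls raw_type_rsubst)
  moreover have "\<lbrakk>Lam x (cls M) \<cdot> cls N\<rbrakk> \<epsilon> = \<lbrakk>cls (M[x :=\<^sub>r N])\<rbrakk> \<epsilon>" if "environment \<epsilon>" for \<epsilon>
  proof -
    have "(\<lambda>y. sem_raw ((RVar(x := N)) y) \<epsilon>) = \<epsilon>(x := sem_raw N \<epsilon>)" by (rule ext) simp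
    \<comment> \<open>This membership is the condition under which applying \<open>Pr\<close> of the
      body amounts to updating the environment.\<close>
    moreover have "sem_raw N \<epsilon> \<in> D (snd x)" using sem_D[OF N that] by (simp add: sem_cls)
    ultimately show ?thesis
      by (simp only: sem_simps sem_cls sem_raw_rsubst fapp_Pr_D[OF finitary_sem_raw])
  qed
  ultimately show ?case by blast
next
  case (appL M M' N)
  from appL.prems obtain \<tau> where "M \<Colon> \<tau> \<Rrightarrow> \<sigma>" "N \<Colon> \<tau>" by (auto simp: has_type_App)
  thus ?case using appL.IH by (auto simp: has_type_App sem_simps)
next
  case (appR N N' M)
  from appR.prems obtain \<tau> where "M \<Colon> \<tau> \<Rrightarrow> \<sigma>" "N \<Colon> \<tau>" by (auto simp: has_type_App)
  thus ?case using appR.IH by (auto simp: has_type_App sem_simps)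
next
  case (lam M M' x)
  from lam.prems obtain \<tau> where "M \<Colon> \<tau>" "snd x \<Rrightarrow> \<tau> \<approx> \<sigma>" by (auto simp: has_type_Lam)
  \<comment> \<open>\<open>Pr\<close> evaluates the body at elements of \<open>D (snd x)\<close>
    only, and updating by such an element keeps an environment, so the induction hypothesis
    applies.\<close>
  thus ?case using lam.IH[of \<tau>]
    by (auto simp: has_type_Lam sem_simps D_def[symmetric] environment_upd
        intro!: Pr_cong[OF prime_presystem_P])
next
  case (case0 \<sigma>1 \<tau>1 \<rho> \<sigma>' \<tau>' x y z)
  hence t: "Const (Inj0 \<sigma>' \<tau>') \<cdot> x \<Colon> \<sigma>1 \<oplus> \<tau>1" "y \<Colon> \<sigma>1 \<Rrightarrow> \<rho>" "z \<Colon> \<tau>1 \<Rrightarrow> \<rho>" "\<rho> \<approx> \<sigma>"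
    by (simp_all add: has_type_Case)
  \<comment> \<open>Two types for \<open>x\<close>: \<open>\<sigma>'\<close> is used to evaluate the
    injection, \<open>\<sigma>1\<close> to type the application of \<open>y\<close>.\<close>
  hence x: "x \<Colon> \<sigma>'" "x \<Colon> \<sigma>1" by (auto simp: has_type_Inj ty_equiv_star has_type_equiv)
  have "y \<cdot> x \<Colon> \<sigma>" using t(2,4) x(2) by (blast intro: has_type.intros)
  thus ?case using t x by (simp add: sem_eval case_el_eqs sem_simps(3)[of y x])
next
  case (case1 \<sigma>1 \<tau>1 \<rho> \<sigma>' \<tau>' x y z)
  hence t: "Const (Inj1 \<sigma>' \<tau>') \<cdot> x \<Colon> \<sigma>1 \<oplus> \<tau>1" "y \<Colon> \<sigma>1 \<Rrightarrow> \<rho>" "z \<Colon> \<tau>1 \<Rrightarrow> \<rho>" "\<rho> \<approx> \<sigma>"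
    by (simp_all add: has_type_Case)
  hence x: "x \<Colon> \<tau>'" "x \<Colon> \<tau>1" by (auto simp: has_type_Inj ty_equiv_star has_type_equiv)
  have "z \<cdot> x \<Colon> \<sigma>" using t(3,4) x(2) by (blast intro: has_type.intros)
  thus ?case
    using t x by (simp add: sem_eval case_el_eqs sem_simps(3)[of z x] del: One_nat_def)
next
  case (fst \<sigma>1 \<tau>1 \<sigma>' \<tau>' x y)
  hence t: "Const (Pair \<sigma>' \<tau>') \<cdot> x \<cdot> y \<Colon> \<sigma>1 \<otimes> \<tau>1" "\<sigma>1 \<approx> \<sigma>"
    by (simp_all add: has_type_proj)
  hence "x \<Colon> \<sigma>'" "y \<Colon> \<tau>'" "x \<Colon> \<sigma>"
    by (auto simp: has_type_Pair ty_equiv_star has_type_equiv)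
  thus ?case using t by (simp add: sem_eval proj_pair_el)
next
  case (snd \<sigma>1 \<tau>1 \<sigma>' \<tau>' x y)
  hence t: "Const (Pair \<sigma>' \<tau>') \<cdot> x \<cdot> y \<Colon> \<sigma>1 \<otimes> \<tau>1" "\<tau>1 \<approx> \<sigma>"
    by (simp_all add: has_type_proj)
  hence "x \<Colon> \<sigma>'" "y \<Colon> \<tau>'" "y \<Colon> \<sigma>"
    by (auto simp: has_type_Pair ty_equiv_star has_type_equiv)
  thus ?case using t by (simp add: sem_eval proj_pair_el del: One_nat_def)
next
  case (pcase0 \<sigma>1 \<tau>1 \<rho> \<sigma>' \<tau>' x y z)
  hence t: "Const (Inj0 \<sigma>' \<tau>') \<cdot> x \<Colon> \<sigma>1 \<oplus> \<tau>1" "y \<Colon> \<rho>" "z \<Colon> \<rho>" "\<rho> \<approx> \<sigma>"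
    by (simp_all add: has_type_PCase)
  hence "x \<Colon> \<sigma>'" "y \<Colon> \<sigma>" by (auto simp: has_type_Inj has_type_equiv)
  thus ?case using t by (simp add: sem_eval pcase_el_eqs)
next
  case (pcase1 \<sigma>1 \<tau>1 \<rho> \<sigma>' \<tau>' x y z)
  hence t: "Const (Inj1 \<sigma>' \<tau>') \<cdot> x \<Colon> \<sigma>1 \<oplus> \<tau>1" "y \<Colon> \<rho>" "z \<Colon> \<rho>" "\<rho> \<approx> \<sigma>"
    by (simp_all add: has_type_PCase)
  hence "x \<Colon> \<tau>'" "z \<Colon> \<sigma>" by (auto simp: has_type_Inj has_type_equiv)
  thus ?case using t by (simp add: sem_eval pcase_el_eqs del: One_nat_def)
next
  case (pcase_inj0 \<sigma>1 \<tau>1 \<rho>0 \<rho>1 x \<sigma>' \<tau>' y \<sigma>'' \<tau>'' z)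
  hence t: "x \<Colon> \<sigma>1 \<oplus> \<tau>1" "Const (Inj0 \<sigma>' \<tau>') \<cdot> y \<Colon> \<rho>0 \<oplus> \<rho>1"
    "Const (Inj0 \<sigma>'' \<tau>'') \<cdot> z \<Colon> \<rho>0 \<oplus> \<rho>1" "\<rho>0 \<oplus> \<rho>1 \<approx> \<sigma>"
    by (simp_all add: has_type_PCase)
  hence yz: "y \<Colon> \<sigma>'" "y \<Colon> \<rho>0" "z \<Colon> \<sigma>''" "z \<Colon> \<rho>0"
    by (auto simp: has_type_Inj ty_equiv_star has_type_equiv)
  have p: "Const (PCase \<sigma>1 \<tau>1 \<rho>0) \<cdot> x \<cdot> y \<cdot> z \<Colon> \<rho>0" using t yz by (simp add: has_type_PCase)
  moreover have "Const (Inj0 \<rho>0 \<rho>1) \<cdot> (Const (PCase \<sigma>1 \<tau>1 \<rho>0) \<cdot> x \<cdot> y \<cdot> z) \<Colon> \<sigma>"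
    using t p by (simp add: has_type_Inj)
  ultimately show ?case using t yz by (simp add: sem_eval pcase_el_inj)
next
  case (pcase_inj1 \<sigma>1 \<tau>1 \<rho>0 \<rho>1 x \<sigma>' \<tau>' y \<sigma>'' \<tau>'' z)
  hence t: "x \<Colon> \<sigma>1 \<oplus> \<tau>1" "Const (Inj1 \<sigma>' \<tau>') \<cdot> y \<Colon> \<rho>0 \<oplus> \<rho>1"
    "Const (Inj1 \<sigma>'' \<tau>'') \<cdot> z \<Colon> \<rho>0 \<oplus> \<rho>1" "\<rho>0 \<oplus> \<rho>1 \<approx> \<sigma>"
    by (simp_all add: has_type_PCase)
  hence yz: "y \<Colon> \<tau>'" "y \<Colon> \<rho>1" "z \<Colon> \<tau>''" "z \<Colon> \<rho>1"
    by (auto simp: has_type_Inj ty_equiv_star has_type_equiv)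
  have p: "Const (PCase \<sigma>1 \<tau>1 \<rho>1) \<cdot> x \<cdot> y \<cdot> z \<Colon> \<rho>1" using t yz by (simp add: has_type_PCase)
  moreover have "Const (Inj1 \<rho>0 \<rho>1) \<cdot> (Const (PCase \<sigma>1 \<tau>1 \<rho>1) \<cdot> x \<cdot> y \<cdot> z) \<Colon> \<sigma>"
    using t p by (simp add: has_type_Inj)
  ultimately show ?case using t yz by (simp add: sem_eval pcase_el_inj)
next
  case (pcase_pair \<sigma>1 \<tau>1 \<rho>1 \<rho>2 x \<sigma>' \<tau>' y1 y2 \<sigma>'' \<tau>'' z1 z2)
  hence t: "x \<Colon> \<sigma>1 \<oplus> \<tau>1" "Const (Pair \<sigma>' \<tau>') \<cdot> y1 \<cdot> y2 \<Colon> \<rho>1 \<otimes> \<rho>2"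
    "Const (Pair \<sigma>'' \<tau>'') \<cdot> z1 \<cdot> z2 \<Colon> \<rho>1 \<otimes> \<rho>2" "\<rho>1 \<otimes> \<rho>2 \<approx> \<sigma>"
    by (simp_all add: has_type_PCase)
  hence yz: "y1 \<Colon> \<sigma>'" "y1 \<Colon> \<rho>1" "y2 \<Colon> \<tau>'" "y2 \<Colon> \<rho>2"
    "z1 \<Colon> \<sigma>''" "z1 \<Colon> \<rho>1" "z2 \<Colon> \<tau>''" "z2 \<Colon> \<rho>2"
    by (auto simp: has_type_Pair ty_equiv_star has_type_equiv)
  let ?p1 = "Const (PCase \<sigma>1 \<tau>1 \<rho>1) \<cdot> x \<cdot> y1 \<cdot> z1" and ?p2 = "Const (PCase \<sigma>1 \<tau>1 \<rho>2) \<cdot> x \<cdot> y2 \<cdot> z2"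
  have p: "?p1 \<Colon> \<rho>1" "?p2 \<Colon> \<rho>2" using t yz by (simp_all add: has_type_PCase)
  moreover have "Const (Pair \<rho>1 \<rho>2) \<cdot> ?p1 \<cdot> ?p2 \<Colon> \<sigma>"
    using t p by (simp add: has_type_Pair)
  ultimately show ?case using t yz by (simp add: sem_eval pcase_el_pair)
next
  case (pcase_fun \<sigma>1 \<tau>1 \<rho>1 \<rho>2 x y z w)
  then obtain \<rho> where "w \<Colon> \<rho>"
    "Const (PCase \<sigma>1 \<tau>1 (\<rho>1 \<Rrightarrow> \<rho>2)) \<cdot> x \<cdot> y \<cdot> z \<Colon> \<rho> \<Rrightarrow> \<sigma>"
    unfolding has_type_App[of _ w] by blast
  hence t: "x \<Colon> \<sigma>1 \<oplus> \<tau>1" "y \<Colon> \<rho>1 \<Rrightarrow> \<rho>2" "z \<Colon> \<rho>1 \<Rrightarrow> \<rho>2" "w \<Colon> \<rho>1" "\<rho>2 \<approx> \<sigma>"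
    by (auto simp: has_type_PCase ty_equiv_star has_type_equiv)
  hence yz: "y \<cdot> w \<Colon> \<rho>2" "z \<cdot> w \<Colon> \<rho>2" by (auto simp: has_type_App)
  \<comment> \<open>The left side applies a \<open>pcase_el\<close> of functions to the value of
    \<open>w\<close>, the right side is a \<open>pcase_el\<close> of the applied values;
    \<open>fapp_pcase_el\<close> exchanges the two.\<close>
  have "\<lbrakk>Const (PCase \<sigma>1 \<tau>1 (\<rho>1 \<Rrightarrow> \<rho>2)) \<cdot> x \<cdot> y \<cdot> z \<cdot> w\<rbrakk> \<epsilon>
      = \<lbrakk>Const (PCase \<sigma>1 \<tau>1 \<rho>2) \<cdot> x \<cdot> (y \<cdot> w) \<cdot> (z \<cdot> w)\<rbrakk> \<epsilon>" if "environment \<epsilon>" for \<epsilon>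
    unfolding sem_simps(3)[of _ w] sem_eval(7)[OF t(1-3) that] sem_eval(7)[OF t(1) yz that]
    by (rule fapp_pcase_el) (rule t(2-4)[THEN sem_D] that)+
  moreover have "Const (PCase \<sigma>1 \<tau>1 \<rho>2) \<cdot> x \<cdot> (y \<cdot> w) \<cdot> (z \<cdot> w) \<Colon> \<sigma>"
    using t(1,5) yz by (simp add: has_type_PCase)
  ultimately show ?case by blast
qed

theorem mainTheorem5:
  fixes M N :: trm and \<sigma> \<tau> :: ty
  assumes "M \<Colon> \<sigma>" and "N \<Colon> \<tau>"
    and "(\<leadsto>)\<^sup>*\<^sup>* M N"
  shows "\<forall>\<epsilon>. environment \<epsilon> \<longrightarrow> \<lbrakk>M\<rbrakk> \<epsilon> = \<lbrakk>N\<rbrakk> \<epsilon>"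
proof -
  from assms(3) have "N \<Colon> \<sigma> \<and> (\<forall>\<epsilon>. environment \<epsilon> \<longrightarrow> \<lbrakk>M\<rbrakk> \<epsilon> = \<lbrakk>N\<rbrakk> \<epsilon>)"
  proof (induction rule: rtranclp_induct)
    case base
    show ?case using assms(1) by simp
  next
    case (step L N)
    thus ?case using red_sound[OF step(2), of \<sigma>] by simp
  qed
  thus ?thesis by blast
qed

end
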